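(* Let $m\ge2$, let $w$ be a Sturmian or periodic (nonzero) infinite word over $\{0,1\}$, and let $A=A(m,w)$. Then the PI-exponent $exp(A^\sharp)$ exists and $$exp(A^\sharp)=1+exp(A)=1+\Phi_0(\beta),\qquad \beta=\frac{1}{m+\alpha},$$ where $\alpha$ is the slope of $w$.
   Context: Algebras are not necessarily associative over a field $F$ of characteristic $0$. For an algebra $R$, $c_n(R)=\dim P_n/(P_n\cap Id(R))$, where $P_n$ is the space of multilinear polynomials in $x_1,\dots,x_n$ of the absolutely free algebra and $Id(R)$ the ideal of identities of $R$; $exp(R)=\lim_{n\to\infty}\sqrt[n]{c_n(R)}$ when this limit exists. $\Phi_0(x)=\frac{1}{x^x(1-x)^{1-x}}$. The algebra $A(m,w)$: put $k_i=m+w_i$; basis $\{a,b\}\cup\{z^{(i)}_j: i\ge1,1\le j\le k_i\}$, products $z^{(i)}_ja=z^{(i)}_{j+1}$ ($1\le j\le k_i-1$), $z^{(i)}_{k_i}b=z^{(i+1)}_1$, all other products of basis elements zero. $A^\sharp$ is $A$ with an external unit adjoined. Sturmian: exactly $n+1$ distinct subwords of length $n$ for every $n$. Slope $\alpha=\pi(w)=\lim_n(w_1+\cdots+w_n)/n>0$. It is known that $exp(A(m,w))$ exists and equals $\Phi_0(\beta)$ with $\beta=1/(m+\alpha)$. *)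

theory Defs
  imports "HOL-Analysis.Analysis" "HOL-Library.Function_Algebras"
begin

text \<open>Nonassociative monomials: binary trees whose leaves are variable indices.\<close>
datatype tree = Leaf nat | Node tree tree

fun leaves :: "tree \<Rightarrow> nat list" where
  "leaves (Leaf i) = [i]"
| "leaves (Node l r) = leaves l @ leaves r"

definition Mon :: "nat \<Rightarrow> tree set" where
  "Mon n = {t. distinct (leaves t) \<and> set (leaves t) = {1..n}}"

text \<open>Polynomials are coefficient functions on monomials; P_n = multilinear ones.\<close>
definition fscale :: "'f::field \<Rightarrow> (tree \<Rightarrow> 'f) \<Rightarrow> (tree \<Rightarrow> 'f)" where
  "fscale c f = (\<lambda>t. c * f t)"

definition Pn :: "nat \<Rightarrow> (tree \<Rightarrow> 'f::field) set" where
  "Pn n = {f. \<forall>t. t \<notin> Mon n \<longrightarrow> f t = 0}"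

text \<open>Algebras: elements are coefficient vectors 'b => 'f over a basis type 'b,
  the algebra R is given by a carrier set (an F-subspace) and a bilinear product.\<close>
fun teval :: "(('b \<Rightarrow> 'f) \<Rightarrow> ('b \<Rightarrow> 'f) \<Rightarrow> ('b \<Rightarrow> 'f)) \<Rightarrow> (nat \<Rightarrow> ('b \<Rightarrow> 'f)) \<Rightarrow> tree \<Rightarrow> ('b \<Rightarrow> 'f)" where
  "teval mul \<phi> (Leaf i) = \<phi> i"
| "teval mul \<phi> (Node l r) = mul (teval mul \<phi> l) (teval mul \<phi> r)"

definition is_identity ::
  "(('b \<Rightarrow> 'f::field) \<Rightarrow> ('b \<Rightarrow> 'f) \<Rightarrow> ('b \<Rightarrow> 'f)) \<Rightarrow> ('b \<Rightarrow> 'f) set \<Rightarrow> nat \<Rightarrow> (tree \<Rightarrow> 'f) \<Rightarrow> bool" where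
  "is_identity mul R n f \<longleftrightarrow>
     (\<forall>\<phi>. (\<forall>i. \<phi> i \<in> R) \<longrightarrow> (\<lambda>c. \<Sum>t\<in>Mon n. f t * teval mul \<phi> t c) = (\<lambda>_. 0))"

text \<open>c_n(R) = dim P_n / (P_n \<inter> Id(R)) = dim P_n - dim (P_n \<inter> Id(R)).\<close>
definition codim ::
  "nat \<Rightarrow> (('b \<Rightarrow> 'f::field) \<Rightarrow> ('b \<Rightarrow> 'f) \<Rightarrow> ('b \<Rightarrow> 'f)) \<Rightarrow> ('b \<Rightarrow> 'f) set \<Rightarrow> nat" where
  "codim n mul R =
     vector_space.dim fscale (Pn n :: (tree \<Rightarrow> 'f) set)
     - vector_space.dim fscale {f \<in> Pn n. is_identity mul R n f}"

definition has_PI_exp ::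
  "(('b \<Rightarrow> 'f::field) \<Rightarrow> ('b \<Rightarrow> 'f) \<Rightarrow> ('b \<Rightarrow> 'f)) \<Rightarrow> ('b \<Rightarrow> 'f) set \<Rightarrow> real \<Rightarrow> bool" where
  "has_PI_exp mul R L \<longleftrightarrow> (\<lambda>n. root n (real (codim n mul R))) \<longlonglongrightarrow> L"

text \<open>Basis: U (the adjoined external unit), a, b, z^(i)_j = Z i j.\<close>
datatype bidx = U | Ba | Bb | Z nat nat

text \<open>k i = m + w i (i >= 1); word w is indexed w 1, w 2, ...\<close>
definition valid_idx :: "(nat \<Rightarrow> nat) \<Rightarrow> bidx \<Rightarrow> bool" where
  "valid_idx k p = (case p of Z i j \<Rightarrow> 1 \<le> i \<and> 1 \<le> j \<and> j \<le> k i | _ \<Rightarrow> True)"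

text \<open>Product of basis elements: Some basis element, or None for zero.\<close>
fun bprod :: "(nat \<Rightarrow> nat) \<Rightarrow> bidx \<Rightarrow> bidx \<Rightarrow> bidx option" where
  "bprod k U y = Some y"
| "bprod k x U = Some x"
| "bprod k (Z i j) Ba = (if 1 \<le> i \<and> 1 \<le> j \<and> j < k i then Some (Z i (j+1)) else None)"
| "bprod k (Z i j) Bb = (if 1 \<le> i \<and> j = k i then Some (Z (i+1) 1) else None)"
| "bprod k x y = None"

definition supp :: "(bidx \<Rightarrow> 'f::zero) \<Rightarrow> bidx set" where
  "supp x = {p. x p \<noteq> 0}"

definition amult :: "(nat \<Rightarrow> nat) \<Rightarrow> (bidx \<Rightarrow> 'f::field) \<Rightarrow> (bidx \<Rightarrow> 'f) \<Rightarrow> (bidx \<Rightarrow> 'f)" where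
  "amult k x y = (\<lambda>c. \<Sum>p\<in>supp x. \<Sum>q\<in>supp y. if bprod k p q = Some c then x p * y q else 0)"

definition kseq :: "nat \<Rightarrow> (nat \<Rightarrow> nat) \<Rightarrow> nat \<Rightarrow> nat" where
  "kseq m w i = m + w i"

definition Asharp_carrier :: "nat \<Rightarrow> (nat \<Rightarrow> nat) \<Rightarrow> (bidx \<Rightarrow> 'f::field) set" where
  "Asharp_carrier m w = {x. finite (supp x) \<and> (\<forall>p\<in>supp x. valid_idx (kseq m w) p)}"

definition A_carrier :: "nat \<Rightarrow> (nat \<Rightarrow> nat) \<Rightarrow> (bidx \<Rightarrow> 'f::field) set" where
  "A_carrier m w = {x \<in> Asharp_carrier m w. x U = 0}"

definition subwords :: "(nat \<Rightarrow> nat) \<Rightarrow> nat \<Rightarrow> nat list set" where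
  "subwords w n = {map w [i..<i+n] | i. 1 \<le> i}"

definition sturmian :: "(nat \<Rightarrow> nat) \<Rightarrow> bool" where
  "sturmian w \<longleftrightarrow> (\<forall>n. card (subwords w n) = n + 1)"

definition periodic_word :: "(nat \<Rightarrow> nat) \<Rightarrow> bool" where
  "periodic_word w \<longleftrightarrow> (\<exists>p>0. \<forall>i\<ge>1. w (i + p) = w i)"

definition Phi0 :: "real \<Rightarrow> real" where
  "Phi0 x = 1 / (x powr x * (1 - x) powr (1 - x))"

end

theory Submission
  imports Defs
begin

text \<open>
  By multilinearity, \<open>c\<^sub>n\<close> is the rank of the family of functionals on \<open>P\<^sub>n\<close> given by substituting basis
  elements. Such a substitution kills every monomial unless the variables \<open>S\<close> that are not replaced by
  the unit form a left-normed monomial, starting with some \<open>z\<close> and followed by letters \<open>a\<close>, \<open>b\<close> spelling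
  the path in the algebra which starts at \<open>z\<close>. Hence a nonzero functional is determined by \<open>S\<close>, the first
  variable, the path pattern and the set of variables replaced by \<open>b\<close>.

  The word \<open>w\<close> has linear complexity, so there are only polynomially many patterns of length \<open>l\<close>, and its
  frequencies converge uniformly (Sturmian words are balanced), so each pattern contains
  \<open>\<beta> l + o(l)\<close> letters \<open>b\<close>. Thus each \<open>S\<close> contributes about \<open>binom(|S|, \<beta> |S|)\<close>, that is
  \<open>\<Phi>\<^sub>0(\<beta>)\<^bsup>|S|\<^esup>\<close> functionals up to subexponential factors, and summing over all subsets \<open>S\<close> of the variables
  gives \<open>(1 + \<Phi>\<^sub>0(\<beta>))\<^sup>n\<close>; for \<open>A\<close> itself only the full set occurs.

  For the lower bound one restricts to sets \<open>S\<close> of a fixed size \<open>l \<ge> 4\<close>, where explicit monomials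
  separate the functionals, and then averages over \<open>l\<close>.
\<close>


section \<open>Codimensions as ranks\<close>

context vector_space
begin

text \<open>\<open>dim\<close> is the cardinality of a basis, hence 0 for an infinite one. The space
  of all functions on trees is infinite-dimensional, so finiteness is supplied by the spanning set
  \<open>F\<close>.\<close>

lemma dim_mono_finite_span:
  assumes "V \<subseteq> W" "W \<subseteq> span F" "finite F"
  shows "dim V \<le> dim W"
proof -
  obtain B where B: "B \<subseteq> V" "independent B" "V \<subseteq> span B" "card B = dim V"
    by (rule basis_exists)
  obtain C where C: "C \<subseteq> W" "independent C" "W \<subseteq> span C" "card C = dim W"
    by (rule basis_exists)
  have "finite C" using independent_span_bound[OF assms(3) C(2)] C(1) assms(2) by blast
  then have "card B \<le> card C"
    using independent_span_bound[OF _ B(2), of C] B(1) assms(1) C(3) by blast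
  then show ?thesis using B C by simp
qed

text \<open>The functionals \<open>g i\<close> vanish on \<open>W\<close> and are dual to the
  vectors \<open>v i\<close>, so these vectors are independent modulo \<open>W\<close>. Later
  \<open>W\<close> is the space of identities inside \<open>V = Pn n\<close>.\<close>

lemma dim_add_card_le_dim:
  fixes g :: "'i \<Rightarrow> 'b \<Rightarrow> 'a" and v :: "'i \<Rightarrow> 'b"
  assumes add: "\<And>i x y. i \<in> I \<Longrightarrow> g i (x + y) = g i x + g i y"
    and scale: "\<And>i c x. i \<in> I \<Longrightarrow> g i (scale c x) = c * g i x"
    and "W \<subseteq> V" "V \<subseteq> span F" "finite F" "finite I"
    and van: "\<And>i x. i \<in> I \<Longrightarrow> x \<in> W \<Longrightarrow> g i x = 0"
    and v: "\<And>i. i \<in> I \<Longrightarrow> v i \<in> V"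
    and delta: "\<And>i j. i \<in> I \<Longrightarrow> j \<in> I \<Longrightarrow> g i (v j) = (if i = j then 1 else 0)"
  shows "dim W + card I \<le> dim V"
proof -
  obtain B where B: "B \<subseteq> W" "independent B" "W \<subseteq> span B" "card B = dim W"
    by (rule basis_exists)
  have finB: "finite B" using independent_span_bound[OF assms(5) B(2)] B(1) assms(3,4) by blast
  have "J \<subseteq> I \<Longrightarrow> independent (B \<union> v ` J) \<and> card (B \<union> v ` J) = dim W + card J" if "finite J" for J
    using that
  proof (induction J)
    case empty
    then show ?case using B by simp
  next
    case (insert a J)
    have IH: "independent (B \<union> v ` J)" "card (B \<union> v ` J) = dim W + card J" and a: "a \<in> I"
      using insert by auto
    have "subspace {x. g a x = 0}"
      using add[OF a] scale[OF a] scale[OF a, of 0 0] by (intro subspaceI) auto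
    moreover have "B \<union> v ` J \<subseteq> {x. g a x = 0}"
      using insert B van[OF a] delta[OF a] by auto
    ultimately have "span (B \<union> v ` J) \<subseteq> {x. g a x = 0}" by (simp add: span_minimal)
    then have nin: "v a \<notin> span (B \<union> v ` J)" using delta[OF a a] by auto
    then have "v a \<notin> B \<union> v ` J" by (rule contrapos_nn) (rule span_base)
    then show ?case using IH nin insert finB by (auto simp: independent_insertI)
  qed
  from this[OF assms(6)] have ind: "independent (B \<union> v ` I)" "card (B \<union> v ` I) = dim W + card I"
    by auto
  have sub: "B \<union> v ` I \<subseteq> V" using B v assms(3) by auto
  have "dim (B \<union> v ` I) = dim W + card I" using dim_eq_card_independent[OF ind(1)] ind(2) by simp
  then show ?thesis using dim_mono_finite_span[OF sub assms(4,5)] by simp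
qed

text \<open>Each functional lowers the dimension by at most one: its kernel together with one vector
  outside it spans the whole space.\<close>

lemma dim_le_dim_kernel_add_card:
  fixes g :: "'i \<Rightarrow> 'b \<Rightarrow> 'a"
  assumes "finite J" "V \<subseteq> span F" "finite F" "subspace V"
    and add: "\<And>j x y. j \<in> J \<Longrightarrow> g j (x + y) = g j x + g j y"
    and scale: "\<And>j c x. j \<in> J \<Longrightarrow> g j (scale c x) = c * g j x"
  shows "dim V \<le> dim {x \<in> V. \<forall>j\<in>J. g j x = 0} + card J"
  using assms(1) add scale
proof (induction J)
  case empty
  then show ?case by simp
next
  case (insert a J)
  let ?V = "{x \<in> V. \<forall>j\<in>J. g j x = 0}" and ?W = "{x \<in> V. \<forall>j\<in>insert a J. g j x = 0}"
  have IH: "dim V \<le> dim ?V + card J" using insert by auto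
  have "dim ?V \<le> Suc (dim ?W)"
  proof (cases "\<exists>v\<in>?V. g a v \<noteq> 0")
    case False
    then have "?V = ?W" by auto
    then show ?thesis by simp
  next
    case True
    then obtain v where v: "v \<in> ?V" "g a v \<noteq> 0" by blast
    obtain B where B: "B \<subseteq> ?W" "independent B" "?W \<subseteq> span B" "card B = dim ?W"
      by (rule basis_exists)
    have "B \<subseteq> span F" using B(1) assms(2) by auto
    then have finB: "finite B" using independent_span_bound[OF assms(3) B(2)] by blast
    have "x \<in> span (insert v B)" if x: "x \<in> ?V" for x
    proof -
      \<comment> \<open>This multiple of \<open>v\<close> moves \<open>x\<close> into the kernel of
        \<open>g a\<close>.\<close>
      define d where "d = - (g a x / g a v)"
      let ?y = "x + scale d v"
      have "g j (x + scale c v) = g j x + c * g j v" if "j \<in> insert a J" for j c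
        using insert.prems that by simp
      moreover have "g a x + d * g a v = 0" using v by (simp add: d_def)
      ultimately have "?y \<in> ?W" using x v assms(4)
        by (auto intro!: subspace_add subspace_scale)
      then have y: "?y \<in> span (insert v B)" using B(3) span_mono[of B "insert v B"] by blast
      have "scale d v \<in> span (insert v B)" by (simp add: span_base span_scale)
      from span_diff[OF y this] show ?thesis by simp
    qed
    then have "dim ?V \<le> card (insert v B)" using finB by (intro dim_le_card) auto
    also have "\<dots> \<le> Suc (dim ?W)" using B(4) finB by (simp add: card_insert_if)
    finally show ?thesis .
  qed
  then show ?case using IH insert by simp
qed

end

section \<open>Multilinear polynomials and bounds for their codimensions\<close>

interpretation polys: vector_space "fscale :: 'f::field \<Rightarrow> (tree \<Rightarrow> 'f) \<Rightarrow> _"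
  by standard (auto simp: fscale_def algebra_simps)

lemma length_leaves_pos: "leaves t \<noteq> []"
  by (induction t) auto

text \<open>A product splits its leaf word into two nonempty and hence shorter words, and there are
  finitely many places to split.\<close>

lemma finite_trees_leaves: "finite {t. leaves t = xs}"
proof (induction xs rule: length_induct)
  case (1 xs)
  let ?X = "\<Union>i\<le>length xs. {t. leaves t = take i xs \<and> length (take i xs) < length xs}"
  let ?Y = "\<Union>i\<le>length xs. {t. leaves t = drop i xs \<and> length (drop i xs) < length xs}"
  have "{t. leaves t = xs} \<subseteq> (\<lambda>i. Leaf i) ` set xs \<union> (\<lambda>(l, r). Node l r) ` (?X \<times> ?Y)"
  proof
    fix t assume t: "t \<in> {t. leaves t = xs}"
    show "t \<in> (\<lambda>i. Leaf i) ` set xs \<union> (\<lambda>(l, r). Node l r) ` (?X \<times> ?Y)"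
    proof (cases t)
      case (Node l r)
      then have xs: "xs = leaves l @ leaves r" using t by simp
      have "l \<in> ?X" "r \<in> ?Y"
        using xs length_leaves_pos[of l] length_leaves_pos[of r]
        by (auto intro!: bexI[of _ "length (leaves l)"])
      then show ?thesis using Node by auto
    qed (use t in auto)
  qed
  moreover have "finite ?X" "finite ?Y" using 1 by (auto intro!: finite_subset[OF _ 1[rule_format]])
  ultimately show ?case by (meson finite_SigmaI finite_UnI finite_imageI finite_set finite_subset)
qed

lemma finite_Mon [simp]: "finite (Mon n)"
proof -
  have "Mon n \<subseteq> (\<Union>xs\<in>{xs. set xs \<subseteq> {1..n} \<and> length xs = n}. {t. leaves t = xs})"
    by (auto simp: Mon_def dest: distinct_card)
  moreover have "finite \<dots>"
    using finite_lists_length_eq[of "{1..n}" n] finite_trees_leaves by auto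
  ultimately show ?thesis using finite_subset by blast
qed

definition tree_mono :: "tree \<Rightarrow> tree \<Rightarrow> 'f::field" where
  "tree_mono t = (\<lambda>s. if s = t then 1 else 0)"

lemma Pn_subset_span: "(Pn n :: (tree \<Rightarrow> 'f::field) set) \<subseteq> polys.span (tree_mono ` Mon n)"
proof
  fix f :: "tree \<Rightarrow> 'f" assume f: "f \<in> Pn n"
  have "f = (\<Sum>t\<in>Mon n. fscale (f t) (tree_mono t))"
  proof
    fix s
    have "(\<Sum>t\<in>Mon n. fscale (f t) (tree_mono t)) s = (\<Sum>t\<in>Mon n. fscale (f t) (tree_mono t) s)"
      by (induction rule: infinite_finite_induct) auto
    also have "\<dots> = (\<Sum>t\<in>Mon n. if t = s then f t else 0)"
      by (intro sum.cong) (auto simp: fscale_def tree_mono_def)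
    also have "\<dots> = f s" using f by (auto simp: Pn_def)
    finally show "f s = (\<Sum>t\<in>Mon n. fscale (f t) (tree_mono t)) s" by simp
  qed
  also have "\<dots> \<in> polys.span (tree_mono ` Mon n)"
    by (intro polys.span_sum polys.span_scale polys.span_base) auto
  finally show "f \<in> polys.span (tree_mono ` Mon n)" .
qed

lemma subspace_Pn: "polys.subspace (Pn n)"
  by (auto intro!: polys.subspaceI simp: Pn_def fscale_def)

text \<open>Substituting \<open>\<phi> i\<close> and reading the coordinate \<open>c i\<close> is a
  linear functional that kills every identity; duality with the monomials \<open>t i\<close> makes
  these functionals independent modulo the identities.\<close>

lemma card_le_codim:
  fixes \<phi> :: "'i \<Rightarrow> nat \<Rightarrow> 'b \<Rightarrow> 'f::field" and t :: "'i \<Rightarrow> tree"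
  assumes "finite I"
    and t: "\<And>i. i \<in> I \<Longrightarrow> t i \<in> Mon n"
    and \<phi>: "\<And>i x. i \<in> I \<Longrightarrow> \<phi> i x \<in> R"
    and delta: "\<And>i j. i \<in> I \<Longrightarrow> j \<in> I \<Longrightarrow> teval mul (\<phi> i) (t j) (c i) = (if i = j then 1 else 0)"
  shows "card I \<le> codim n mul R"
proof -
  let ?Id = "{f \<in> Pn n. is_identity mul R n f} :: (tree \<Rightarrow> 'f) set"
  let ?g = "\<lambda>i f. \<Sum>s\<in>Mon n. f s * teval mul (\<phi> i) s (c i)"
  have "polys.dim ?Id + card I \<le> polys.dim (Pn n :: (tree \<Rightarrow> 'f) set)"
  proof (rule polys.dim_add_card_le_dim[where g = ?g and v = "\<lambda>i. tree_mono (t i)" and F = "tree_mono ` Mon n"])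
    show "Pn n \<subseteq> polys.span (tree_mono ` Mon n :: (tree \<Rightarrow> 'f) set)" by (rule Pn_subset_span)
    show "?g i f = 0" if "i \<in> I" "f \<in> ?Id" for i f
      using that \<phi> by (auto simp: is_identity_def dest!: spec[of _ "\<phi> i"] fun_cong[of _ _ "c i"])
    show "tree_mono (t i) \<in> Pn n" if "i \<in> I" for i
      using t[OF that] by (auto simp: Pn_def tree_mono_def)
    show "?g i (tree_mono (t j)) = (if i = j then 1 else 0)" if "i \<in> I" "j \<in> I" for i j
    proof -
      have "?g i (tree_mono (t j)) = (\<Sum>s\<in>Mon n. if s = t j then teval mul (\<phi> i) s (c i) else 0)"
        by (intro sum.cong) (auto simp: tree_mono_def)
      then show ?thesis using t that delta by simp
    qed
  qed (use assms in \<open>auto simp: fscale_def algebra_simps sum.distrib sum_distrib_left\<close>)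
  then show ?thesis unfolding codim_def by linarith
qed

text \<open>The coefficient sums over the sets in \<open>\<N>\<close> are functionals whose common
  kernel consists of identities. The sets will be the supports of evaluations at basis
  elements.\<close>

lemma codim_le_card:
  fixes R :: "('b \<Rightarrow> 'f::field) set"
  assumes "finite \<N>"
    and id: "\<And>f. f \<in> Pn n \<Longrightarrow> \<forall>N\<in>\<N>. (\<Sum>t\<in>N. f t) = 0 \<Longrightarrow> is_identity mul R n f"
  shows "codim n mul R \<le> card \<N>"
proof -
  let ?Id = "{f \<in> Pn n. is_identity mul R n f} :: (tree \<Rightarrow> 'f) set"
  let ?K = "{f \<in> Pn n. \<forall>N\<in>\<N>. (\<Sum>t\<in>N. f t) = 0} :: (tree \<Rightarrow> 'f) set"
  have "polys.dim (Pn n :: (tree \<Rightarrow> 'f) set) \<le> polys.dim ?K + card \<N>"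
    by (rule polys.dim_le_dim_kernel_add_card[OF assms(1) Pn_subset_span])
      (auto simp: subspace_Pn sum.distrib fscale_def sum_distrib_left)
  moreover have "polys.dim ?K \<le> polys.dim ?Id"
    by (rule polys.dim_mono_finite_span[where F = "tree_mono ` Mon n"])
      (use id Pn_subset_span in auto)
  ultimately show ?thesis unfolding codim_def by linarith
qed

section \<open>Balance of Sturmian words\<close>

definition factor :: "(nat \<Rightarrow> 'a) \<Rightarrow> nat \<Rightarrow> nat \<Rightarrow> 'a list" where
  "factor x L p = map x [p..<p + L]"

lemma factor_eq_iff: "factor x L p = factor x L q \<longleftrightarrow> (\<forall>i<L. x (p + i) = x (q + i))"
  by (auto simp: factor_def list_eq_iff_nth_eq)

lemma factor_Suc_eq_iff:
  "factor x (Suc L) p = factor x (Suc L) q \<longleftrightarrow> factor x L p = factor x L q \<and> x (p + L) = x (q + L)"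
  by (auto simp: factor_eq_iff less_Suc_eq)

text \<open>A right special factor has two extensions. If two different factors were right special,
  one extension of each could be dropped and every factor of length \<open>L\<close> would still be
  a prefix of a remaining one, so the complexity would grow by at least 2.\<close>

lemma right_special_unique:
  assumes fin: "finite (range (factor x (Suc L)))"
    and card: "card (range (factor x (Suc L))) \<le> Suc (card (range (factor x L)))"
    and st: "factor x L s = factor x L t" "x (s + L) \<noteq> x (t + L)"
    and st': "factor x L s' = factor x L t'" "x (s' + L) \<noteq> x (t' + L)"
  shows "factor x L s = factor x L s'"
proof (rule ccontr)
  assume neq: "factor x L s \<noteq> factor x L s'"
  let ?A = "range (factor x (Suc L))"
  let ?A' = "?A - {factor x (Suc L) s, factor x (Suc L) s'}"
  have tk: "take L (factor x (Suc L) p) = factor x L p" for p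
    by (simp add: factor_def take_map)
  have t: "factor x (Suc L) t \<in> ?A'" "factor x (Suc L) t' \<in> ?A'"
    using st st' neq by (auto simp: factor_Suc_eq_iff)
  have "range (factor x L) \<subseteq> take L ` ?A'"
  proof
    fix u assume "u \<in> range (factor x L)"
    then obtain p where p: "u = factor x L p" by auto
    show "u \<in> take L ` ?A'"
    proof (cases "factor x (Suc L) p \<in> ?A'")
      case True
      then show ?thesis using tk p by (metis image_eqI)
    next
      case False
      then have "u = factor x L t \<or> u = factor x L t'"
        using p st st' by (auto simp: factor_Suc_eq_iff)
      then show ?thesis using t tk by (metis image_eqI)
    qed
  qed
  then have "card (range (factor x L)) \<le> card ?A'"
    using fin by (meson card_image_le card_mono finite_Diff finite_imageI le_trans)
  moreover have "card ?A' = card ?A - 2"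
    using neq fin by (subst card_Diff_subset) (auto simp: factor_Suc_eq_iff)
  moreover have "card ?A \<ge> 2"
    using card_mono[of ?A "{factor x (Suc L) s, factor x (Suc L) s'}"] neq fin
    by (auto simp: factor_Suc_eq_iff)
  ultimately show False using card by linarith
qed

lemma eventually_periodic_card_factors:
  assumes "d > 0" and per: "\<And>i. i \<ge> N \<Longrightarrow> x (i + d) = x i"
  shows "card (range (factor x L)) \<le> N + d"
proof -
  have "factor x L p \<in> factor x L ` {..<N + d}" for p
  proof (induction p rule: less_induct)
    case (less p)
    show ?case
    proof (cases "p < N + d")
      case False
      then have "factor x L p = factor x L (p - d)"
        using per[of "p - d + i" for i] by (auto simp: factor_eq_iff algebra_simps)
      then show ?thesis using less[of "p - d"] False assms(1) by simp
    qed simp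
  qed
  then have "card (range (factor x L)) \<le> card (factor x L ` {..<N + d})"
    by (intro card_mono) auto
  then show ?thesis using card_image_le[of "{..<N + d}" "factor x L"] by simp
qed

definition fsum :: "(nat \<Rightarrow> nat) \<Rightarrow> nat \<Rightarrow> nat \<Rightarrow> nat" where
  "fsum x p L = (\<Sum>i<L. x (p + i))"

lemma fsum_0 [simp]: "fsum x p 0 = 0"
  by (simp add: fsum_def)

lemma fsum_Suc: "fsum x p (Suc L) = fsum x p L + x (p + L)"
  by (simp add: fsum_def)

lemma fsum_Suc_shift: "fsum x p (Suc L) = x p + fsum x (Suc p) L"
  unfolding fsum_def by (subst sum.lessThan_Suc_shift) simp

lemma fsum_add: "fsum x p (L + M) = fsum x p L + fsum x (p + L) M"
  by (induction M) (simp_all add: fsum_Suc add_ac)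

text \<open>At an interior cut both halves are balanced by minimality, so the left halves differ by
  exactly 1. Hence the two words differ only in their first and last letters. The palindrome comes
  from comparing prefixes of one word with suffixes of the other.\<close>

lemma minimal_unbalanced:
  assumes bin: "\<And>i. x i \<in> {0, 1}"
    and unb: "fsum x p n > fsum x q n + 1"
    and min: "\<And>L p q. L < n \<Longrightarrow> fsum x p L \<le> fsum x q L + 1"
  obtains N where "n = N + 2" "x p = 1" "x q = 0" "x (p + Suc N) = 1" "x (q + Suc N) = 0"
    "\<forall>i<N. x (p + Suc i) = x (q + Suc i)" "\<forall>i<N. x (p + Suc i) = x (p + N - i)"
proof -
  have bin': "x i \<le> 1" for i using bin[of i] by auto
  have n2: "n \<noteq> 0" "n \<noteq> 1" using unb bin'[of p] by (auto simp: fsum_def intro: ccontr)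
  define N where "N = n - 2"
  have n: "n = N + 2" using n2 by (simp add: N_def)
  have D: "fsum x p i = fsum x q i + 1" if "0 < i" "i < n" for i
  proof -
    have "fsum x (p + i) (n - i) \<le> fsum x (q + i) (n - i) + 1" using that by (intro min) auto
    moreover have "fsum x p i \<le> fsum x q i + 1" using that by (intro min)
    moreover have "fsum x r n = fsum x r i + fsum x (r + i) (n - i)" for r
      using fsum_add[of x r i "n - i"] that by simp
    note this[of p] this[of q]
    ultimately show ?thesis using unb by linarith
  qed
  have 1: "x p = 1" "x q = 0" using D[of 1] n bin'[of p] by (auto simp: fsum_def)
  have 2: "x (p + Suc i) = x (q + Suc i)" if "i < N" for i
    using D[of "Suc i"] D[of "Suc (Suc i)"] that n fsum_Suc[of x _ "Suc i"] by simp
  have 3: "x (p + Suc N) = 1" "x (q + Suc N) = 0"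
    using D[of "Suc N"] unb n fsum_Suc[of x _ "Suc N"] bin'[of "p + Suc N"] by auto
  have 4: "x (p + Suc i) = x (p + N - i)" if "i < N" for i
    using that
  proof (induction i rule: less_induct)
    case (less i)
    have IH: "x (p + Suc j) = x (p + N - j)" if "j < i" for j using less that by auto
    let ?v = "\<Sum>j<i. x (p + Suc j)"
    have mid: "fsum x (Suc p) i = ?v" "fsum x (Suc q) i = ?v"
      using 2 less.prems by (auto simp: fsum_def intro!: sum.cong)
    \<comment> \<open>By the induction hypothesis the last \<open>i\<close> letters of the common
      middle block are its first \<open>i\<close> letters reversed, so they have the same
      sum.\<close>
    have suf: "fsum x (Suc (r + N - i)) i = ?v" if r: "r = p \<or> r = q" for r
    proof -
      have "fsum x (Suc (r + N - i)) i = (\<Sum>j<i. x (Suc (r + N - i) + (i - Suc j)))"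
        unfolding fsum_def by (rule sum.nat_diff_reindex[symmetric])
      also have "\<dots> = ?v"
      proof (intro sum.cong refl)
        fix j assume "j \<in> {..<i}"
        then have j: "j < i" by simp
        then have "Suc (r + N - i) + (i - Suc j) = r + Suc (N - Suc j)" using less.prems by simp
        moreover have "x (r + Suc (N - Suc j)) = x (p + Suc (N - Suc j))"
          using r 2[of "N - Suc j"] less.prems j by auto
        moreover have "p + Suc (N - Suc j) = p + N - j" using less.prems j by simp
        ultimately show "x (Suc (r + N - i) + (i - Suc j)) = x (p + Suc j)" using IH[OF j] by metis
      qed
      finally show ?thesis .
    qed
    have pre: "fsum x r (Suc (Suc i)) = x r + fsum x (Suc r) i + x (r + Suc i)" for r
      by (simp add: fsum_Suc_shift[of x r i] fsum_Suc[of x r "Suc i"])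
    have post: "fsum x (r + N - i) (Suc (Suc i)) = x (r + N - i) + fsum x (Suc (r + N - i)) i + x (r + Suc N)" for r
      using pre[of "r + N - i"] less.prems by (simp)
    have e: "x (q + N - i) = x (p + N - i)" using 2[of "N - Suc i"] less.prems by (simp add: Suc_diff_Suc)
    \<comment> \<open>Minimality applies since \<open>i + 2 < n\<close>. The end letters are 1 for
      the word at \<open>p\<close> and 0 for the word at \<open>q\<close>, and the inner sums
      cancel, leaving an inequality in each direction.\<close>
    have "fsum x p (Suc (Suc i)) \<le> fsum x (q + N - i) (Suc (Suc i)) + 1"
      "fsum x (p + N - i) (Suc (Suc i)) \<le> fsum x q (Suc (Suc i)) + 1"
      using less.prems n by (simp_all only: min)
    then have "x (p + Suc i) \<le> x (p + N - i)" "x (p + N - i) \<le> x (p + Suc i)"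
      using pre[of p] pre[of q] post[of p] post[of q] mid suf[of p] suf[of q] 1 3 e 2[OF less.prems]
      by simp_all
    then show ?case by simp
  qed
  show thesis using that n 1 2 3 4 by blast
qed

text \<open>The Coven--Hedlund argument: a shortest unbalanced pair has the form \<open>1v1\<close>, \<open>0v0\<close> with \<open>v\<close> a
  palindrome. If \<open>cv\<close> is the right special factor of its length and \<open>d \<noteq> c\<close>, then the palindrome
  \<open>v\<close> keeps \<open>cv\<close> from starting inside \<open>dvd\<close>, so the word is eventually periodic.\<close>

lemma complexity_imp_balanced:
  assumes bin: "\<And>i. x i \<in> {0, 1}"
    and card: "\<And>L. card (range (factor x L)) = L + 1"
  shows "fsum x p L \<le> fsum x q L + 1"
proof (rule ccontr)
  assume "\<not> ?thesis"
  then have ex: "\<exists>n p q. fsum x p n > fsum x q n + 1" by (auto simp: not_le)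
  define n where "n = (LEAST n. \<exists>p q. fsum x p n > fsum x q n + 1)"
  obtain P Q where unb: "fsum x P n > fsum x Q n + 1"
    using LeastI_ex[OF ex] by (auto simp: n_def)
  have min: "\<And>L p q. L < n \<Longrightarrow> fsum x p L \<le> fsum x q L + 1"
    using not_less_Least[of _ "\<lambda>n. \<exists>p q. fsum x p n > fsum x q n + 1"] by (force simp: n_def not_less)
  obtain N where "n = N + 2" and N: "x P = 1" "x Q = 0" "x (P + Suc N) = 1" "x (Q + Suc N) = 0"
    and "\<forall>i<N. x (P + Suc i) = x (Q + Suc i)" "\<forall>i<N. x (P + Suc i) = x (P + N - i)"
    by (rule minimal_unbalanced[OF bin unb min])
  then have PQ: "\<And>i. i < N \<Longrightarrow> x (P + Suc i) = x (Q + Suc i)"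
    and pal: "\<And>i. i < N \<Longrightarrow> x (P + Suc i) = x (P + N - i)" by auto
  have fin: "finite (range (factor x L))" for L
    using card[of L] by (metis Suc_eq_plus1 card.infinite nat.distinct(1))
  have unique: "factor x L s = factor x L s'"
    if "factor x L s = factor x L t" "x (s + L) \<noteq> x (t + L)"
       "factor x L s' = factor x L t'" "x (s' + L) \<noteq> x (t' + L)" for L s t s' t'
    using right_special_unique[OF fin _ that] card by simp
  \<comment> \<open>The tail of a right special factor is right special of length \<open>N\<close>,
    and so is the common middle block; by uniqueness they agree. The first letter then selects
    \<open>P\<close> or \<open>Q\<close>. If nothing is right special, either choice works.\<close>
  have "\<exists>c. c \<in> {P, Q} \<and> (\<forall>s t. factor x (Suc N) s = factor x (Suc N) t \<longrightarrow> x (s + Suc N) \<noteq> x (t + Suc N)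
          \<longrightarrow> factor x (Suc N) s = factor x (Suc N) c)"
  proof (cases "\<exists>s t. factor x (Suc N) s = factor x (Suc N) t \<and> x (s + Suc N) \<noteq> x (t + Suc N)")
    case False
    then show ?thesis by blast
  next
    case True
    then obtain s t where st: "factor x (Suc N) s = factor x (Suc N) t" "x (s + Suc N) \<noteq> x (t + Suc N)"
      by blast
    have "factor x N (Suc s) = factor x N (Suc P)"
    proof (rule unique)
      show "factor x N (Suc s) = factor x N (Suc t)" "x (Suc s + N) \<noteq> x (Suc t + N)"
        using st by (auto simp: factor_eq_iff)
      show "factor x N (Suc P) = factor x N (Suc Q)" "x (Suc P + N) \<noteq> x (Suc Q + N)"
        using N PQ by (auto simp: factor_eq_iff)
    qed
    then have v: "x (s + Suc i) = x (P + Suc i)" if "i < N" for i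
      using that by (auto simp: factor_eq_iff)
    obtain c where c: "c \<in> {P, Q}" "x s = x c" using bin[of s] N by (metis insertCI empty_iff insertE)
    have "factor x (Suc N) s = factor x (Suc N) c"
      unfolding factor_eq_iff
    proof safe
      fix i assume "i < Suc N"
      then show "x (s + i) = x (c + i)" using c v PQ by (cases i) auto
    qed
    moreover have "factor x (Suc N) s' = factor x (Suc N) s"
      if "factor x (Suc N) s' = factor x (Suc N) t'" "x (s' + Suc N) \<noteq> x (t' + Suc N)" for s' t'
      using unique[OF that st] .
    ultimately show ?thesis using c(1) by metis
  qed
  then obtain c where c: "c \<in> {P, Q}"
    and det: "\<And>s t. factor x (Suc N) s = factor x (Suc N) t \<Longrightarrow> factor x (Suc N) s \<noteq> factor x (Suc N) c
      \<Longrightarrow> x (s + Suc N) = x (t + Suc N)" by metis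
  define d where "d = (if c = P then Q else P)"
  have cd: "x c \<noteq> x d" "x (d + Suc N) = x d" and d: "d \<in> {P, Q}" using c N by (auto simp: d_def)
  have vd: "x (d + Suc i) = x (P + Suc i)" "x (c + Suc i) = x (P + Suc i)" if "i < N" for i
    using that c d PQ by auto
  have avoid: "factor x (Suc N) (d + i) \<noteq> factor x (Suc N) c" if i: "i \<le> Suc N" for i
  proof
    assume eq: "factor x (Suc N) (d + i) = factor x (Suc N) c"
    then have eq': "x (d + i + j) = x (c + j)" if "j \<le> N" for j using that by (auto simp: factor_eq_iff)
    have "x (d + i) = x c" using eq'[of 0] by simp
    then have "i \<noteq> 0" "i \<noteq> Suc N" using cd by (metis add.right_neutral, metis)
    then obtain j where j: "i = Suc j" "j < N" using i by (cases i) auto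
    \<comment> \<open>If the factor at \<open>c\<close> reappeared at offset \<open>j + 1\<close>,
      reflecting the middle block would identify the last letter \<open>x (d + Suc N)\<close>, which
      is \<open>x d\<close>, with \<open>x c\<close>.\<close>
    have "x (d + Suc N) = x (c + Suc (N - Suc j))" using eq'[of "N - j"] j by (simp add: Suc_diff_Suc)
    also have "\<dots> = x (P + Suc (N - Suc j))" using j by (intro vd) simp
    also have "\<dots> = x (P + Suc j)" using pal[OF j(2)] j(2) by (simp add: Suc_diff_Suc)
    also have "\<dots> = x (d + i)" using vd j by simp
    also have "\<dots> = x c" using eq'[of 0] by simp
    finally show False using cd by simp
  qed
  \<comment> \<open>There are \<open>N + 2\<close> offsets but only \<open>N + 1\<close> factors of
    this length other than the one at \<open>c\<close>, so two offsets carry the same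
    factor.\<close>
  let ?F = "range (factor x (Suc N)) - {factor x (Suc N) c}"
  have "card ?F = Suc N" using card[of "Suc N"] fin by simp
  moreover have "(\<lambda>i. factor x (Suc N) (d + i)) ` {..Suc N} \<subseteq> ?F" using avoid by auto
  then have "card ((\<lambda>i. factor x (Suc N) (d + i)) ` {..Suc N}) \<le> card ?F"
    using fin by (intro card_mono) auto
  ultimately have "\<not> inj_on (\<lambda>i. factor x (Suc N) (d + i)) {..Suc N}"
    by (intro pigeonhole) simp
  then obtain i' j' where ij': "i' \<le> Suc N" "j' \<le> Suc N" "i' \<noteq> j'"
    "factor x (Suc N) (d + i') = factor x (Suc N) (d + j')" unfolding inj_on_def by auto
  define i j where "i = min i' j'" and "j = max i' j'"
  have ij: "i < j" "j \<le> Suc N" "factor x (Suc N) (d + i) = factor x (Suc N) (d + j)"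
    using ij' by (auto simp: i_def j_def min_def max_def)
  \<comment> \<open>Away from the factor at \<open>c\<close> the next letter is determined, so
    equality of factors propagates one step to the right.\<close>
  have shift: "factor x (Suc N) (Suc s) = factor x (Suc N) (Suc t)"
    if "factor x (Suc N) s = factor x (Suc N) t" "factor x (Suc N) s \<noteq> factor x (Suc N) c" for s t
  proof -
    have "factor x (Suc (Suc N)) s = factor x (Suc (Suc N)) t"
      using that det[OF that] by (simp add: factor_Suc_eq_iff[of x "Suc N"])
    then show ?thesis by (auto simp: factor_eq_iff)
  qed
  \<comment> \<open>The second conjunct keeps the orbit among the windows at offsets
    \<open>i\<close> to \<open>j - 1\<close>, none of which is the factor at \<open>c\<close>, so
    that \<open>shift\<close> applies again.\<close>
  have per: "factor x (Suc N) (d + i + k) = factor x (Suc N) (d + j + k) \<and>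
    factor x (Suc N) (d + i + k) \<in> (\<lambda>l. factor x (Suc N) (d + l)) ` {i..<j}" for k
  proof (induction k)
    case 0
    then show ?case using ij(1) by (auto simp: ij(3)[symmetric])
  next
    case (Suc k)
    then obtain l where l: "l \<in> {i..<j}" "factor x (Suc N) (d + i + k) = factor x (Suc N) (d + l)" by auto
    then have nc: "factor x (Suc N) (d + i + k) \<noteq> factor x (Suc N) c" using avoid[of l] ij by auto
    have e: "factor x (Suc N) (Suc (d + i + k)) = factor x (Suc N) (Suc (d + j + k))"
      using shift Suc nc by blast
    have "factor x (Suc N) (Suc (d + i + k)) = factor x (Suc N) (d + Suc l)"
      using shift[OF l(2) nc] by simp
    moreover have "\<exists>l'\<in>{i..<j}. factor x (Suc N) (d + Suc l) = factor x (Suc N) (d + l')"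
    proof (cases "Suc l = j")
      case True
      then show ?thesis using ij by (intro bexI[of _ i]) auto
    next
      case False
      then show ?thesis using l(1) by (intro bexI[of _ "Suc l"]) auto
    qed
    ultimately show ?case using e by auto
  qed
  have "x (s + (j - i)) = x s" if "s \<ge> d + i" for s
  proof -
    have "x (d + j + (s - (d + i))) = x (d + i + (s - (d + i)))"
      using per[of "s - (d + i)"] by (auto simp: factor_eq_iff)
    moreover have "d + j + (s - (d + i)) = s + (j - i)" "d + i + (s - (d + i)) = s"
      using that ij by auto
    ultimately show ?thesis by simp
  qed
  then have "card (range (factor x L)) \<le> d + i + (j - i)" for L
    using ij(1) by (intro eventually_periodic_card_factors) auto
  then show False using card[of "d + i + (j - i)"] by (metis Suc_eq_plus1 not_less_eq_eq order_refl)
qed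

text \<open>Sturmian and periodic words are treated uniformly through linear complexity and bounded
  discrepancy of block sums. Balance gives \<open>C = 1\<close> in the Sturmian case; a period
  serves as \<open>C\<close> in the periodic case.\<close>

lemma sturmian_or_periodic_bounds:
  assumes bin: "\<forall>i\<ge>1. w i \<in> {0, 1}" and w: "sturmian w \<or> periodic_word w"
  obtains C where "\<And>n. finite (subwords w n)" "\<And>n. card (subwords w n) \<le> n + C"
    "\<And>p L. p \<ge> 1 \<Longrightarrow> \<bar>int (fsum w p L) - int (fsum w 1 L)\<bar> \<le> int C"
proof -
  define x where "x i = w (Suc i)" for i
  have sub: "subwords w n = range (factor x n)" for n
  proof -
    have "map w [Suc p..<Suc p + n] = factor x n p" for p
      by (rule nth_equalityI) (auto simp: factor_def x_def simp del: upt_Suc)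
    moreover have "subwords w n = (\<lambda>i. map w [i..<i + n]) ` {1..}" by (auto simp: subwords_def)
    moreover have "{1..} = range Suc" by (auto dest: Suc_le_D)
    ultimately show ?thesis by (simp add: image_image)
  qed
  have fsum_x: "fsum w (Suc p) L = fsum x p L" for p L by (simp add: fsum_def x_def)
  have binx: "x i \<in> {0, 1}" for i using bin by (simp add: x_def)
  have fin: "finite (subwords w n)" for n
  proof (rule finite_subset)
    show "subwords w n \<subseteq> {xs. set xs \<subseteq> {0, 1} \<and> length xs = n}"
      unfolding sub using binx by (force simp: factor_def)
  qed (simp add: finite_lists_length_eq)
  show thesis
    using w
  proof
    assume "sturmian w"
    then have card: "card (range (factor x n)) = n + 1" for n by (simp add: sturmian_def sub)
    have bal: "fsum x p L \<le> fsum x q L + 1" for p q L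
      by (rule complexity_imp_balanced[OF binx card])
    show thesis
    proof (rule that[of 1])
      fix p L :: nat assume "p \<ge> 1"
      then obtain p' where "p = Suc p'" by (cases p) auto
      then show "\<bar>int (fsum w p L) - int (fsum w 1 L)\<bar> \<le> int 1"
        using bal[of p' L 0] bal[of 0 L p'] fsum_x[of 0] fsum_x by (simp add: abs_le_iff)
    qed (use fin card sub in auto)
  next
    assume "periodic_word w"
    then obtain d where "d > 0" "\<forall>i\<ge>1. w (i + d) = w i" by (auto simp: periodic_word_def)
    then have d: "d > 0" "\<And>i. x (i + d) = x i" by (simp_all add: x_def flip: add_Suc)
    have mod: "x (i mod d) = x i" for i
    proof (induction i rule: less_induct)
      case (less i)
      then show ?case
        using d less[of "i - d"] by (cases "i < d") (auto simp: le_mod_geq not_less, metis le_add_diff_inverse2)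
    qed
    have le: "fsum x p L \<le> L" for p L
    proof -
      have "x i \<le> 1" for i using binx[of i] by auto
      then show ?thesis unfolding fsum_def using sum_bounded_above[of "{..<L}" "\<lambda>i. x (p + i)" 1] by simp
    qed
    \<comment> \<open>The start may be reduced modulo \<open>d\<close>; sliding a window by fewer
      than \<open>d\<close> positions exchanges fewer than \<open>d\<close> letters at each
      end.\<close>
    have "\<bar>int (fsum x p L) - int (fsum x 0 L)\<bar> \<le> int d" for p L
    proof -
      have "fsum x p L = fsum x (p mod d) L"
        unfolding fsum_def by (intro sum.cong refl) (metis mod mod_add_left_eq)
      moreover have "fsum x 0 (p mod d) + fsum x (p mod d) L = fsum x 0 L + fsum x L (p mod d)"
        using fsum_add[of x 0 "p mod d" L] fsum_add[of x 0 L "p mod d"] by (simp add: add.commute)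
      moreover have "p mod d < d" using d by simp
      ultimately show ?thesis using le[of 0 "p mod d"] le[of L "p mod d"] by linarith
    qed
    note disc = this
    show thesis
    proof (rule that[of d])
      fix p L :: nat assume "p \<ge> 1"
      then obtain p' where "p = Suc p'" by (cases p) auto
      then show "\<bar>int (fsum w p L) - int (fsum w 1 L)\<bar> \<le> int d"
        using disc fsum_x[of 0] fsum_x by simp
    next
      fix n
      have "card (range (factor x n)) \<le> 0 + d"
        using d by (intro eventually_periodic_card_factors) auto
      then show "card (subwords w n) \<le> n + d" using sub by simp
    qed (rule fin)
  qed
qed

section \<open>Binomial coefficients and exponential growth\<close>

definition entropy :: "real \<Rightarrow> real" where
  "entropy q = - (q * ln q + (1 - q) * ln (1 - q))"

lemma Phi0_eq_exp_entropy: "0 < q \<Longrightarrow> q < 1 \<Longrightarrow> Phi0 q = exp (entropy q)"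
  unfolding Phi0_def entropy_def exp_minus by (simp add: powr_def inverse_eq_divide flip: exp_add)

lemma Phi0_gt_1:
  assumes "0 < q" "q < 1"
  shows "Phi0 q > 1"
proof -
  have "q * ln q + (1 - q) * ln (1 - q) < 0" using assms by (intro add_neg_neg mult_pos_neg) auto
  then show ?thesis using assms by (simp add: Phi0_eq_exp_entropy entropy_def)
qed

text \<open>A single term in the expansion of \<open>(q + (1 - q)) ^ n\<close> is at most 1, which
  is the bound for \<open>t = q n\<close>; a deviation of \<open>t\<close> from \<open>q n\<close>
  costs a factor exponential in that deviation.\<close>

lemma binomial_le_exp:
  assumes q: "0 < q" "q < 1" and t: "t \<le> n" and e: "\<bar>real t - q * real n\<bar> \<le> e"
  shows "real (n choose t) \<le> Phi0 q ^ n * exp (\<bar>ln q - ln (1 - q)\<bar> * e)"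
proof -
  let ?f = "\<lambda>k. real (n choose k) * q ^ k * (1 - q) ^ (n - k)"
  let ?E = "real t * ln q + real (n - t) * ln (1 - q)"
  have "?f t \<le> (\<Sum>k\<le>n. ?f k)" using q t by (intro member_le_sum) auto
  also have "\<dots> = 1" using binomial_ring[of q "1 - q" n] by simp
  finally have "real (n choose t) * (q ^ t * (1 - q) ^ (n - t)) \<le> 1" by (simp add: mult.assoc)
  moreover have "q ^ t * (1 - q) ^ (n - t) = exp ?E"
    using q by (simp add: exp_add exp_of_nat_mult)
  ultimately have 1: "real (n choose t) \<le> exp (- ?E)"
    unfolding exp_minus by (simp add: field_simps)
  have "- ?E = real n * entropy q - (real t - q * real n) * (ln q - ln (1 - q))"
    using t by (simp add: entropy_def of_nat_diff algebra_simps)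
  also have "\<dots> \<le> real n * entropy q + \<bar>ln q - ln (1 - q)\<bar> * e"
  proof -
    have "- ((real t - q * real n) * (ln q - ln (1 - q))) \<le> \<bar>(real t - q * real n) * (ln q - ln (1 - q))\<bar>"
      by linarith
    also have "\<dots> \<le> \<bar>ln q - ln (1 - q)\<bar> * e"
      using mult_right_mono[OF e, of "\<bar>ln q - ln (1 - q)\<bar>"] by (simp add: abs_mult mult.commute)
    finally show ?thesis by simp
  qed
  finally have "exp (- ?E) \<le> exp (real n * entropy q + \<bar>ln q - ln (1 - q)\<bar> * e)" by simp
  also have "\<dots> = Phi0 q ^ n * exp (\<bar>ln q - ln (1 - q)\<bar> * e)"
    using q by (simp add: Phi0_eq_exp_entropy exp_add exp_of_nat_mult)
  finally show ?thesis using 1 by linarith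
qed

text \<open>\<open>k ^ k / fact k\<close> is one term of the exponential series at
  \<open>k\<close>.\<close>

lemma ln_fact_lower: "k > 0 \<Longrightarrow> real k * ln (real k) - real k \<le> ln (fact k)"
proof -
  assume k: "k > 0"
  have "real k ^ k / fact k \<le> exp (real k)"
  proof -
    have s: "(\<lambda>n. real k ^ n /\<^sub>R fact n) sums exp (real k)" by (rule exp_converges)
    have "(\<Sum>n\<in>{k}. real k ^ n /\<^sub>R fact n) \<le> (\<Sum>n. real k ^ n /\<^sub>R fact n)"
      using s by (intro sum_le_suminf) (auto simp: sums_iff)
    then show ?thesis using s by (simp add: sums_iff field_simps)
  qed
  then have "ln (real k ^ k / fact k) \<le> real k" using k
    by (metis ln_exp ln_le_cancel_iff divide_pos_pos exp_gt_zero fact_gt_zero of_nat_0_less_iff zero_less_power)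
  then show ?thesis using k by (simp add: ln_div ln_realpow)
qed

text \<open>The induction step amounts to
  \<open>(k + 1) * (ln (k + 1) - ln k) \<ge> 1\<close>.\<close>

lemma ln_fact_upper: "k > 0 \<Longrightarrow> ln (fact k) \<le> real k * ln (real k) - real k + ln (real k) + 1"
proof (induction k rule: nat_induct_non_zero)
  case 1
  then show ?case by simp
next
  case (Suc k)
  let ?k = "real k"
  have "ln (1 + 1 / ?k) \<ge> 1 / (?k + 1)"
  proof -
    have "ln (?k / (?k + 1)) \<le> ?k / (?k + 1) - 1" using Suc(1) by (intro ln_le_minus_one) auto
    also have "\<dots> = - (1 / (?k + 1))" by (simp add: field_simps)
    finally have "- ln (?k / (?k + 1)) \<ge> 1 / (?k + 1)" by simp
    moreover have "- ln (?k / (?k + 1)) = ln (1 + 1 / ?k)"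
      using Suc(1) by (subst ln_inverse[symmetric]) (auto simp: field_simps)
    ultimately show ?thesis by simp
  qed
  moreover have "ln (1 + 1 / ?k) = ln (?k + 1) - ln ?k"
    using Suc(1) ln_div[of "?k + 1" ?k] by (simp add: add_divide_distrib)
  ultimately have "1 / (?k + 1) \<le> ln (?k + 1) - ln ?k" by simp
  then have "(?k + 1) * (1 / (?k + 1)) \<le> (?k + 1) * (ln (?k + 1) - ln ?k)"
    by (intro mult_left_mono) auto
  then have "1 \<le> (?k + 1) * (ln (?k + 1) - ln ?k)" by simp
  moreover have "ln (fact (Suc k) :: real) = ln (?k + 1) + ln (fact k)"
    by (simp add: ln_mult add.commute)
  ultimately show ?case using Suc(2) by (simp add: algebra_simps)
qed

text \<open>The linear terms of the factorial bounds cancel because \<open>t + (n - t) = n\<close>;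
  the logarithms of \<open>t\<close> and \<open>n - t\<close> are at most
  \<open>ln n\<close>.\<close>

lemma ln_binomial_lower:
  assumes "0 < t" "t < n"
  shows "real n * entropy (real t / real n) - 2 * ln (real n) - 2 \<le> ln (real (n choose t))"
proof -
  let ?n = "real n" and ?t = "real t" and ?s = "real (n - t)"
  have "ln (real (n choose t)) = ln (fact n) - ln (fact t) - ln (fact (n - t))"
    using assms by (simp add: binomial_fact ln_div ln_mult)
  also have "\<dots> \<ge> (?n * ln ?n - ?n) - (?t * ln ?t - ?t + ln ?t + 1) - (?s * ln ?s - ?s + ln ?s + 1)"
    using ln_fact_lower[of n] ln_fact_upper[of t] ln_fact_upper[of "n - t"] assms by auto
  finally have 1: "ln (real (n choose t)) \<ge> ?n * ln ?n - ?t * ln ?t - ?s * ln ?s - ln ?t - ln ?s - 2"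
    using assms by (simp add: of_nat_diff)
  have "ln ?t \<le> ln ?n" "ln ?s \<le> ln ?n" using assms by auto
  moreover have "?n * entropy (?t / ?n) = ?n * ln ?n - ?t * ln ?t - ?s * ln ?s"
  proof -
    have e: "1 - ?t / ?n = ?s / ?n" using assms by (simp add: field_simps of_nat_diff)
    have l: "ln (?t / ?n) = ln ?t - ln ?n" "ln (?s / ?n) = ln ?s - ln ?n"
      using assms by (simp_all add: ln_div del: of_nat_diff)
    have "?n * - (?t / ?n * A + ?s / ?n * B) = - (?t * A + ?s * B)" for A B
      using assms by (simp add: field_simps del: of_nat_diff)
    then have "?n * entropy (?t / ?n) = - (?t * (ln ?t - ln ?n) + ?s * (ln ?s - ln ?n))"
      unfolding entropy_def e l .
    also have "\<dots> = (?t + ?s) * ln ?n - ?t * ln ?t - ?s * ln ?s" by (simp add: algebra_simps)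
    finally show ?thesis using assms by (simp add: of_nat_diff)
  qed
  ultimately show ?thesis using 1 by linarith
qed

text \<open>The exponent is \<open>Suc n\<close> because a monomial in \<open>n + 1\<close>
  variables gives a path with \<open>n\<close> letters, the first variable being its start.\<close>

lemma eventually_binomial_ge:
  assumes q: "0 < q" "q < 1" and T: "(\<lambda>n. real (T n) / real n) \<longlonglongrightarrow> q"
    and y: "0 < y" "y < Phi0 q"
  shows "\<forall>\<^sub>F n in sequentially. y ^ Suc n \<le> real (n choose T n)"
proof -
  \<comment> \<open>\<open>n * ?g n\<close> is the lower bound from \<open>ln_binomial_lower\<close>
    minus \<open>(n + 1) * ln y\<close>.\<close>
  let ?g = "\<lambda>n. entropy (real (T n) / real n) - ln y - (2 + ln y) / real n - 2 * (ln (real n) / real n)"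
  have cont: "(\<lambda>n. entropy (real (T n) / real n)) \<longlonglongrightarrow> entropy q"
    unfolding entropy_def using q by (intro tendsto_intros T) auto
  have "?g \<longlonglongrightarrow> entropy q - ln y - 0 - 2 * 0"
    by (intro tendsto_intros cont lim_const_over_n lim_ln_over_n)
  moreover have "ln y < ln (exp (entropy q))"
    using y q by (subst ln_less_cancel_iff) (auto simp: Phi0_eq_exp_entropy)
  then have "entropy q - ln y - 0 - 2 * 0 > 0" by simp
  ultimately have "\<forall>\<^sub>F n in sequentially. ?g n > 0" by (rule order_tendstoD(1))
  moreover have "\<forall>\<^sub>F n in sequentially. real (T n) / real n > 0" "\<forall>\<^sub>F n in sequentially. real (T n) / real n < 1"
    using order_tendstoD[OF T] q by auto
  moreover have "\<forall>\<^sub>F n in sequentially. n > 0" by (rule eventually_gt_at_top)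
  ultimately show ?thesis
  proof eventually_elim
    case (elim n)
    then have t: "0 < T n" "T n < n" by (auto simp: field_simps)
    have "0 \<le> real n * ?g n" using elim by simp
    also have "real n * ?g n = real n * entropy (real (T n) / real n) - real n * ln y - (2 + ln y) - 2 * ln (real n)"
      using elim(4) by (simp add: field_simps)
    finally have "real (Suc n) * ln y \<le> ln (real (n choose T n))"
      using ln_binomial_lower[OF t] by (simp add: algebra_simps)
    then have "ln (y ^ Suc n) \<le> ln (real (n choose T n))" using y by (simp add: ln_realpow del: power_Suc)
    then show ?case using y t by (subst (asm) ln_le_cancel_iff) auto
  qed
qed

section \<open>Subexponential factors and \<open>n\<close>-th roots\<close>

lemma linear_times_power_le:
  fixes r s :: real
  assumes "0 < r" "r < s"
  obtains K where "K > 0" "\<And>k. real (k + 1) * r ^ k \<le> K * s ^ k"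
proof -
  have "(\<lambda>n. of_nat n * (r / s) ^ n) \<longlonglongrightarrow> 0" using assms by (intro powser_times_n_limit_0) auto
  moreover have "(\<lambda>n. (r / s) ^ n) \<longlonglongrightarrow> 0" using assms by (intro LIMSEQ_realpow_zero) auto
  ultimately have "(\<lambda>n. of_nat n * (r / s) ^ n + (r / s) ^ n) \<longlonglongrightarrow> 0 + 0" by (rule tendsto_add)
  then have "Bseq (\<lambda>n. of_nat n * (r / s) ^ n + (r / s) ^ n)"
    by (meson convergentI convergent_imp_Bseq)
  then obtain K where K: "K > 0" "\<And>n. norm (of_nat n * (r / s) ^ n + (r / s) ^ n) \<le> K"
    by (rule BseqE) blast
  have "real (k + 1) * r ^ k \<le> K * s ^ k" for k
  proof -
    have "real (k + 1) * (r / s) ^ k \<le> K" using K(2)[of k] by (simp add: algebra_simps)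
    then show ?thesis using assms by (simp add: power_divide field_simps)
  qed
  then show thesis using that K(1) by blast
qed

text \<open>\<open>T k\<close> will be the set of weights of the patterns available for
  \<open>k\<close> variables. One factor \<open>k + 1\<close> pays for the choice of the first
  variable, the other for the linearly growing number of patterns.\<close>

lemma quadratic_times_binomial_le:
  fixes T :: "nat \<Rightarrow> nat set"
  assumes q: "0 < q" "q < 1" and y: "y > Phi0 q"
    and T: "\<And>e. e > 0 \<Longrightarrow> \<exists>K. \<forall>k. \<forall>t\<in>T k. t \<le> k \<and> \<bar>real t - q * real k\<bar> \<le> e * real k + K"
  shows "\<exists>K>0. \<forall>k. \<forall>t\<in>T k. real (k + 1) ^ 2 * real (k choose t) \<le> K * y ^ k"
proof -
  define \<kappa> where "\<kappa> = \<bar>ln q - ln (1 - q)\<bar>"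
  define h where "h = entropy q"
  have Phi: "Phi0 q = exp h" using q by (simp add: Phi0_eq_exp_entropy h_def)
  then have y0: "y > 0" using y by (metis exp_gt_zero order_less_trans)
  have "h < ln y" using y y0 by (metis Phi exp_less_cancel_iff exp_ln)
  \<comment> \<open>The gap between \<open>ln y\<close> and \<open>ln (Phi0 q)\<close> is split into
    three: one part for the deviation of \<open>t\<close> from \<open>q k\<close> and one for each
    linear factor.\<close>
  define d where "d = (ln y - h) / 3"
  have d: "d > 0" using \<open>h < ln y\<close> by (simp add: d_def)
  have k0: "\<kappa> \<ge> 0" by (simp add: \<kappa>_def)
  obtain K0 where K0: "\<And>k t. t \<in> T k \<Longrightarrow> t \<le> k \<and> \<bar>real t - q * real k\<bar> \<le> d / (\<kappa> + 1) * real k + K0"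
    using T[of "d / (\<kappa> + 1)"] d k0 by auto
  let ?r = "exp (h + d)" and ?s = "exp (h + 2 * d)"
  have "h + 3 * d = ln y" by (simp add: d_def field_simps)
  then have "y = exp (h + 3 * d)" using y0 by simp
  then have rs: "0 < ?r" "?r < ?s" "0 < ?s" "?s < y" using d by auto
  obtain K1 where K1: "K1 > 0" "\<And>k. real (k + 1) * ?r ^ k \<le> K1 * ?s ^ k"
    using linear_times_power_le[OF rs(1,2)] by blast
  obtain K2 where K2: "K2 > 0" "\<And>k. real (k + 1) * ?s ^ k \<le> K2 * y ^ k"
    using linear_times_power_le[OF rs(3,4)] by blast
  show ?thesis
  proof (intro exI[of _ "K1 * K2 * exp (\<kappa> * K0)"] conjI allI ballI)
    fix k t assume "t \<in> T k"
    note K0[OF this]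
    then have "real (k choose t) \<le> Phi0 q ^ k * exp (\<kappa> * (d / (\<kappa> + 1) * real k + K0))"
      unfolding \<kappa>_def by (intro binomial_le_exp q) auto
    also have "\<dots> \<le> ?r ^ k * exp (\<kappa> * K0)"
    proof -
      have "\<kappa> * (d / (\<kappa> + 1)) \<le> d" using k0 d by (simp add: field_simps)
      then have "\<kappa> * (d / (\<kappa> + 1)) * real k \<le> d * real k" by (intro mult_right_mono) auto
      then have "\<kappa> * (d / (\<kappa> + 1) * real k + K0) \<le> d * real k + \<kappa> * K0"
        by (simp add: distrib_left mult.assoc)
      then have "exp h ^ k * exp (\<kappa> * (d / (\<kappa> + 1) * real k + K0)) \<le> exp h ^ k * exp (d * real k + \<kappa> * K0)"
        by simp
      also have "\<dots> = ?r ^ k * exp (\<kappa> * K0)"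
        by (simp add: exp_of_nat_mult[symmetric] exp_add[symmetric] algebra_simps)
      finally show ?thesis by (simp add: Phi)
    qed
    finally have "real (k + 1) ^ 2 * real (k choose t) \<le> real (k + 1) * (real (k + 1) * ?r ^ k) * exp (\<kappa> * K0)"
      by (simp add: power2_eq_square mult.assoc mult_left_mono)
    also have "\<dots> \<le> real (k + 1) * (K1 * ?s ^ k) * exp (\<kappa> * K0)"
      using K1 by (intro mult_right_mono mult_left_mono) auto
    also have "\<dots> = K1 * (real (k + 1) * ?s ^ k) * exp (\<kappa> * K0)" by (simp add: mult_ac)
    also have "\<dots> \<le> K1 * (K2 * y ^ k) * exp (\<kappa> * K0)"
      using K1 K2 by (intro mult_right_mono mult_left_mono) auto
    finally show "real (k + 1) ^ 2 * real (k choose t) \<le> K1 * K2 * exp (\<kappa> * K0) * y ^ k"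
      by (simp add: mult_ac)
  qed (use K1 K2 in simp)
qed

lemma root_tendsto_of_exponential_bounds:
  fixes c :: "nat \<Rightarrow> real"
  assumes L: "0 < L" and c: "\<And>n. 0 \<le> c n"
    and upper: "\<And>y. L < y \<Longrightarrow> \<exists>K>0. \<forall>\<^sub>F n in sequentially. c n \<le> K * y ^ n"
    and lower: "\<And>y. 0 < y \<Longrightarrow> y < L \<Longrightarrow> \<exists>K>0. \<forall>\<^sub>F n in sequentially. K * y ^ n \<le> real n * c n"
  shows "(\<lambda>n. root n (c n)) \<longlonglongrightarrow> L"
proof (rule order_tendstoI)
  fix a assume "L < a"
  then obtain y where y: "L < y" "y < a" using dense by blast
  obtain K where K: "K > 0" "\<forall>\<^sub>F n in sequentially. c n \<le> K * y ^ n" using upper[OF y(1)] by blast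
  have "(\<lambda>n. root n K * y) \<longlonglongrightarrow> 1 * y" using K by (intro tendsto_intros LIMSEQ_root_const)
  then have "\<forall>\<^sub>F n in sequentially. root n K * y < a" using y by (intro order_tendstoD(2)) auto
  with K(2) eventually_gt_at_top[of 0] show "\<forall>\<^sub>F n in sequentially. root n (c n) < a"
  proof eventually_elim
    case (elim n)
    have "root n (c n) \<le> root n (K * y ^ n)" using elim by simp
    also have "\<dots> = root n K * y" using elim y L by (simp add: real_root_mult real_root_power_cancel)
    finally show ?case using elim by simp
  qed
next
  fix a assume "a < L"
  then obtain y where y: "max a (L / 2) < y" "y < L" using dense[of "max a (L / 2)" L] L by auto
  then have y0: "0 < y" using L by simp
  obtain K where K: "K > 0" "\<forall>\<^sub>F n in sequentially. K * y ^ n \<le> real n * c n" using lower[OF y0 y(2)] by blast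
  have "(\<lambda>n. root n K * y / root n (real n)) \<longlonglongrightarrow> 1 * y / 1"
    using K by (intro tendsto_intros LIMSEQ_root_const LIMSEQ_root) auto
  then have "\<forall>\<^sub>F n in sequentially. root n K * y / root n (real n) > a" using y by (intro order_tendstoD(1)) auto
  with K(2) eventually_gt_at_top[of 0] show "\<forall>\<^sub>F n in sequentially. root n (c n) > a"
  proof eventually_elim
    case (elim n)
    have "root n K * y / root n (real n) = root n (K * y ^ n / real n)"
      using elim y0 by (simp add: real_root_mult real_root_divide real_root_power_cancel)
    also have "\<dots> \<le> root n (c n)" using elim by (simp add: field_simps)
    finally show ?case using elim by simp
  qed
qed

section \<open>Evaluation on basis elements\<close>

lemma amult_eq_sum:
  assumes "finite X" "supp x \<subseteq> X" "finite Y" "supp y \<subseteq> Y"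
  shows "amult k x y c = (\<Sum>p\<in>X. \<Sum>q\<in>Y. if bprod k p q = Some c then x p * y q else 0)"
proof -
  have "(\<Sum>q\<in>supp y. if bprod k p q = Some c then x p * y q else 0)
      = (\<Sum>q\<in>Y. if bprod k p q = Some c then x p * y q else 0)" for p
    using assms by (intro sum.mono_neutral_left) (auto simp: supp_def)
  moreover have "(\<Sum>p\<in>supp x. \<Sum>q\<in>Y. if bprod k p q = Some c then x p * y q else 0)
      = (\<Sum>p\<in>X. \<Sum>q\<in>Y. if bprod k p q = Some c then x p * y q else 0)"
    using assms by (intro sum.mono_neutral_left) (auto simp: supp_def if_distrib cong: if_cong intro!: sum.neutral)
  ultimately show ?thesis by (simp add: amult_def)
qed

lemma supp_lincomb_subset: "supp (\<lambda>c. \<Sum>p\<in>P. a p * g p c) \<subseteq> (\<Union>p\<in>P. supp (g p))"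
  for a :: "'b \<Rightarrow> 'f::field"
proof
  fix c assume "c \<in> supp (\<lambda>c. \<Sum>p\<in>P. a p * g p c)"
  then have "(\<Sum>p\<in>P. a p * g p c) \<noteq> 0" by (simp add: supp_def)
  then obtain p where "p \<in> P" "a p * g p c \<noteq> 0" by (rule sum.not_neutral_contains_not_neutral)
  then show "c \<in> (\<Union>p\<in>P. supp (g p))" by (auto simp: supp_def)
qed

lemma amult_lincomb_left:
  fixes a :: "'b \<Rightarrow> 'f::field"
  assumes "finite P" "\<And>p. p \<in> P \<Longrightarrow> finite (supp (g p))" "finite (supp y)"
  shows "amult k (\<lambda>c. \<Sum>p\<in>P. a p * g p c) y c = (\<Sum>p\<in>P. a p * amult k (g p) y c)"
proof -
  let ?X = "\<Union>p\<in>P. supp (g p)"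
  have X: "finite ?X" using assms by auto
  have "amult k (\<lambda>c. \<Sum>p\<in>P. a p * g p c) y c
      = (\<Sum>r\<in>?X. \<Sum>q\<in>supp y. if bprod k r q = Some c then (\<Sum>p\<in>P. a p * g p r) * y q else 0)"
    by (rule amult_eq_sum) (use X assms in \<open>simp_all add: supp_lincomb_subset\<close>)
  also have "\<dots> = (\<Sum>r\<in>?X. \<Sum>q\<in>supp y. \<Sum>p\<in>P. a p * (if bprod k r q = Some c then g p r * y q else 0))"
    by (intro sum.cong refl) (simp add: sum_distrib_right mult.assoc)
  also have "\<dots> = (\<Sum>r\<in>?X. \<Sum>p\<in>P. \<Sum>q\<in>supp y. a p * (if bprod k r q = Some c then g p r * y q else 0))"
    by (intro sum.cong refl sum.swap)
  also have "\<dots> = (\<Sum>p\<in>P. \<Sum>r\<in>?X. \<Sum>q\<in>supp y. a p * (if bprod k r q = Some c then g p r * y q else 0))"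
    by (rule sum.swap)
  also have "\<dots> = (\<Sum>p\<in>P. a p * amult k (g p) y c)"
  proof (intro sum.cong refl)
    fix p assume "p \<in> P"
    then have "amult k (g p) y c = (\<Sum>r\<in>?X. \<Sum>q\<in>supp y. if bprod k r q = Some c then g p r * y q else 0)"
      by (intro amult_eq_sum) (use X assms in auto)
    then show "(\<Sum>r\<in>?X. \<Sum>q\<in>supp y. a p * (if bprod k r q = Some c then g p r * y q else 0)) = a p * amult k (g p) y c"
      by (simp only: sum_distrib_left)
  qed
  finally show ?thesis .
qed

lemma amult_lincomb_right:
  fixes a :: "'b \<Rightarrow> 'f::field"
  assumes "finite P" "\<And>p. p \<in> P \<Longrightarrow> finite (supp (g p))" "finite (supp x)"
  shows "amult k x (\<lambda>c. \<Sum>p\<in>P. a p * g p c) c = (\<Sum>p\<in>P. a p * amult k x (g p) c)"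
proof -
  let ?X = "\<Union>p\<in>P. supp (g p)"
  have X: "finite ?X" using assms by auto
  have "amult k x (\<lambda>c. \<Sum>p\<in>P. a p * g p c) c
      = (\<Sum>r\<in>supp x. \<Sum>q\<in>?X. if bprod k r q = Some c then x r * (\<Sum>p\<in>P. a p * g p q) else 0)"
    by (rule amult_eq_sum) (use X assms in \<open>simp_all add: supp_lincomb_subset\<close>)
  also have "\<dots> = (\<Sum>r\<in>supp x. \<Sum>q\<in>?X. \<Sum>p\<in>P. a p * (if bprod k r q = Some c then x r * g p q else 0))"
    by (intro sum.cong refl) (simp add: sum_distrib_left mult_ac)
  also have "\<dots> = (\<Sum>r\<in>supp x. \<Sum>p\<in>P. \<Sum>q\<in>?X. a p * (if bprod k r q = Some c then x r * g p q else 0))"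
    by (intro sum.cong refl sum.swap)
  also have "\<dots> = (\<Sum>p\<in>P. \<Sum>r\<in>supp x. \<Sum>q\<in>?X. a p * (if bprod k r q = Some c then x r * g p q else 0))"
    by (rule sum.swap)
  also have "\<dots> = (\<Sum>p\<in>P. a p * amult k x (g p) c)"
  proof (intro sum.cong refl)
    fix p assume "p \<in> P"
    then have "amult k x (g p) c = (\<Sum>r\<in>supp x. \<Sum>q\<in>?X. if bprod k r q = Some c then x r * g p q else 0)"
      by (intro amult_eq_sum) (use X assms in auto)
    then show "(\<Sum>r\<in>supp x. \<Sum>q\<in>?X. a p * (if bprod k r q = Some c then x r * g p q else 0)) = a p * amult k x (g p) c"
      by (simp only: sum_distrib_left)
  qed
  finally show ?thesis .
qed

lemma finite_supp_amult:
  assumes "finite (supp x)" "finite (supp y)"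
  shows "finite (supp (amult k x y))"
proof (rule finite_subset)
  show "supp (amult k x y) \<subseteq> (\<lambda>(p, q). the (bprod k p q)) ` (supp x \<times> supp y)"
  proof
    fix c assume "c \<in> supp (amult k x y)"
    then have "(\<Sum>p\<in>supp x. \<Sum>q\<in>supp y. if bprod k p q = Some c then x p * y q else 0) \<noteq> 0"
      by (simp add: supp_def amult_def)
    then obtain p where p: "p \<in> supp x" "(\<Sum>q\<in>supp y. if bprod k p q = Some c then x p * y q else 0) \<noteq> 0"
      by (rule sum.not_neutral_contains_not_neutral)
    from p(2) obtain q where q: "q \<in> supp y" "(if bprod k p q = Some c then x p * y q else 0) \<noteq> 0"
      by (rule sum.not_neutral_contains_not_neutral)
    then have "bprod k p q = Some c" by (auto split: if_splits)
    then show "c \<in> (\<lambda>(p, q). the (bprod k p q)) ` (supp x \<times> supp y)" using p(1) q(1) by force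
  qed
qed (use assms in auto)

lemma finite_supp_teval:
  "(\<And>i. finite (supp (\<phi> i))) \<Longrightarrow> finite (supp (teval (amult k) \<phi> t))"
  by (induction t) (auto simp: finite_supp_amult)

lemma teval_cong:
  "(\<And>i. i \<in> set (leaves t) \<Longrightarrow> \<phi> i = \<phi>' i) \<Longrightarrow> teval mul \<phi> t = teval mul \<phi>' t"
  by (induction t) auto

definition bvec :: "bidx \<Rightarrow> bidx \<Rightarrow> 'f::field" where
  "bvec p = (\<lambda>c. if c = p then 1 else 0)"

lemma supp_bvec [simp]: "supp (bvec p :: bidx \<Rightarrow> 'f::field) = {p}"
  by (auto simp: supp_def bvec_def)

text \<open>Since the leaves are distinct, \<open>i\<close> occurs in only one factor of a product
  and the other factor ignores the update; bilinearity of the product does the rest.\<close>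

lemma teval_lincomb:
  fixes x :: "bidx \<Rightarrow> 'f::field"
  assumes "distinct (leaves t)" "i \<in> set (leaves t)" "\<And>j. finite (supp (\<phi> j))" "finite (supp x)"
  shows "teval (amult k) (\<phi>(i := x)) t = (\<lambda>c. \<Sum>p\<in>supp x. x p * teval (amult k) (\<phi>(i := bvec p)) t c)"
  using assms(1,2)
proof (induction t)
  case (Leaf j)
  have "(\<Sum>p\<in>supp x. x p * bvec p c) = (\<Sum>p\<in>supp x. if p = c then x p else 0)" for c
    by (intro sum.cong) (auto simp: bvec_def)
  also have "\<dots> c = x c" for c using assms(4) by (auto simp: supp_def)
  finally show ?case using Leaf by auto
next
  case (Node l r)
  have fin: "finite (supp (teval (amult k) (\<phi>(i := bvec p)) t))" for p t
    using assms(3) by (intro finite_supp_teval) auto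
  show ?case
  proof (cases "i \<in> set (leaves l)")
    case True
    then have "i \<notin> set (leaves r)" using Node.prems by auto
    then have r: "teval (amult k) (\<phi>(i := v)) r = teval (amult k) \<phi> r" for v
      by (intro teval_cong) auto
    have l: "teval (amult k) (\<phi>(i := x)) l = (\<lambda>c. \<Sum>p\<in>supp x. x p * teval (amult k) (\<phi>(i := bvec p)) l c)"
      using Node.prems True by (intro Node.IH) auto
    show ?thesis
      unfolding teval.simps l r
      by (rule ext, rule amult_lincomb_left) (simp_all add: assms fin finite_supp_teval)
  next
    case False
    then have l: "teval (amult k) (\<phi>(i := v)) l = teval (amult k) \<phi> l" for v
      by (intro teval_cong) auto
    have r: "teval (amult k) (\<phi>(i := x)) r = (\<lambda>c. \<Sum>p\<in>supp x. x p * teval (amult k) (\<phi>(i := bvec p)) r c)"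
      using Node.prems False by (intro Node.IH) auto
    show ?thesis
      unfolding teval.simps l r
      by (rule ext, rule amult_lincomb_right) (simp_all add: assms fin finite_supp_teval)
  qed
qed

text \<open>By multilinearity a polynomial that vanishes on basis vectors vanishes everywhere; the
  variables are expanded one after another.\<close>

lemma is_identity_if_basis:
  fixes f :: "tree \<Rightarrow> 'f::field"
  assumes "V \<noteq> {}"
    and basis: "\<And>\<psi> c. range \<psi> \<subseteq> V \<Longrightarrow> (\<Sum>t\<in>Mon n. f t * teval (amult k) (\<lambda>i. bvec (\<psi> i)) t c) = 0"
  shows "is_identity (amult k) {x. finite (supp x) \<and> supp x \<subseteq> V} n f"
proof -
  let ?g = "\<lambda>\<phi> c. \<Sum>t\<in>Mon n. f t * teval (amult k) \<phi> t c"
  \<comment> \<open>Variables up to \<open>j\<close> are still arbitrary; all others have been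
    specialised to basis vectors.\<close>
  have step: "?g \<phi> c = 0"
    if "j \<le> n" "\<And>i. finite (supp (\<phi> i)) \<and> supp (\<phi> i) \<subseteq> V" "\<And>i. i \<notin> {1..j} \<Longrightarrow> \<exists>p\<in>V. \<phi> i = bvec p" for j \<phi> c
    using that
  proof (induction j arbitrary: \<phi>)
    case 0
    have "\<exists>p. p \<in> V \<and> \<phi> i = bvec p" for i using 0(3)[of i] by auto
    then have "\<forall>i. \<exists>p. p \<in> V \<and> \<phi> i = bvec p" ..
    then obtain \<psi> where \<psi>: "\<forall>i. \<psi> i \<in> V \<and> \<phi> i = bvec (\<psi> i)" by (rule choice[THEN exE])
    then have "\<phi> = (\<lambda>i. bvec (\<psi> i))" by auto
    then show ?case using basis[of \<psi> c] \<psi> by auto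
  next
    case (Suc j)
    let ?i = "Suc j"
    have "teval (amult k) \<phi> t c = (\<Sum>p\<in>supp (\<phi> ?i). \<phi> ?i p * teval (amult k) (\<phi>(?i := bvec p)) t c)"
      if "t \<in> Mon n" for t
    proof -
      have "teval (amult k) (\<phi>(?i := \<phi> ?i)) t = (\<lambda>c. \<Sum>p\<in>supp (\<phi> ?i). \<phi> ?i p * teval (amult k) (\<phi>(?i := bvec p)) t c)"
        using that Suc.prems by (intro teval_lincomb) (auto simp: Mon_def)
      then show ?thesis by (simp add: fun_eq_iff)
    qed
    then have "?g \<phi> c = (\<Sum>t\<in>Mon n. \<Sum>p\<in>supp (\<phi> ?i). \<phi> ?i p * (f t * teval (amult k) (\<phi>(?i := bvec p)) t c))"
      by (intro sum.cong) (simp_all add: sum_distrib_left mult_ac)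
    also have "\<dots> = (\<Sum>p\<in>supp (\<phi> ?i). \<phi> ?i p * ?g (\<phi>(?i := bvec p)) c)"
      by (subst sum.swap) (simp add: sum_distrib_left)
    also have "\<dots> = 0"
    proof (intro sum.neutral ballI)
      fix p assume p: "p \<in> supp (\<phi> ?i)"
      then have "p \<in> V" using Suc.prems by auto
      have "?g (\<phi>(?i := bvec p)) c = 0"
        using Suc.prems \<open>p \<in> V\<close> by (intro Suc.IH) auto
      then show "\<phi> ?i p * ?g (\<phi>(?i := bvec p)) c = 0" by simp
    qed
    finally show ?case .
  qed
  obtain p0 where p0: "p0 \<in> V" using assms(1) by auto
  have "?g \<phi> c = 0" if \<phi>: "\<And>i. finite (supp (\<phi> i)) \<and> supp (\<phi> i) \<subseteq> V" for \<phi> c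
  proof -
    let ?\<phi> = "\<lambda>i. if i \<in> {1..n} then \<phi> i else bvec p0"
    have "?g ?\<phi> c = 0" using p0 \<phi> by (intro step[of n]) auto
    moreover have "teval (amult k) ?\<phi> t = teval (amult k) \<phi> t" if "t \<in> Mon n" for t
      using that by (intro teval_cong) (auto simp: Mon_def)
    ultimately show ?thesis by simp
  qed
  then show ?thesis unfolding is_identity_def by auto
qed

section \<open>Monomials on basis elements as walks\<close>

fun beval :: "(nat \<Rightarrow> nat) \<Rightarrow> (nat \<Rightarrow> bidx) \<Rightarrow> tree \<Rightarrow> bidx option" where
  "beval k \<psi> (Leaf i) = Some (\<psi> i)"
| "beval k \<psi> (Node l r) =
    Option.bind (beval k \<psi> l) (\<lambda>p. Option.bind (beval k \<psi> r) (\<lambda>q. bprod k p q))"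

lemma amult_bvec: "amult k (bvec p) (bvec q) = (\<lambda>c. if bprod k p q = Some c then 1 else 0)"
  by (rule ext) (simp add: amult_def, simp add: bvec_def)

lemma amult_zero: "amult k (\<lambda>_. 0) y = (\<lambda>_. 0)" "amult k x (\<lambda>_. 0) = (\<lambda>_. 0)"
  by (auto simp: amult_def supp_def)

lemma teval_bvec:
  "teval (amult k) (\<lambda>i. bvec (\<psi> i)) t = (\<lambda>c. if beval k \<psi> t = Some c then 1 else 0 :: 'f::field)"
proof (induction t)
  case (Leaf i)
  show ?case by (auto simp: bvec_def)
next
  case (Node l r)
  define ov :: "bidx option \<Rightarrow> bidx \<Rightarrow> 'f" where "ov q = (\<lambda>c. if q = Some c then 1 else 0)" for q
  have ov: "ov None = (\<lambda>_. 0)" "\<And>p. ov (Some p) = bvec p" by (auto simp: ov_def bvec_def)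
  have m: "amult k (bvec p) (bvec q) = ov (bprod k p q)" for p q unfolding ov_def by (rule amult_bvec)
  have "amult k (ov (beval k \<psi> l)) (ov (beval k \<psi> r)) = ov (beval k \<psi> (Node l r))"
    by (cases "beval k \<psi> l"; cases "beval k \<psi> r") (simp_all add: ov m amult_zero)
  then show ?case unfolding teval.simps Node.IH unfolding ov_def .
qed

fun walk :: "(nat \<Rightarrow> nat) \<Rightarrow> bidx \<Rightarrow> bidx list \<Rightarrow> bidx option" where
  "walk k p [] = Some p"
| "walk k p (q # qs) = Option.bind (bprod k p q) (\<lambda>p'. walk k p' qs)"

lemma walk_append: "walk k p (qs @ rs) = Option.bind (walk k p qs) (\<lambda>p'. walk k p' rs)"
proof (induction qs arbitrary: p)
  case (Cons q qs)
  then show ?case by (cases "bprod k p q") auto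
qed simp

text \<open>\<open>lword S t\<close> is the word of the leaves of \<open>t\<close> in \<open>S\<close>, provided that substituting the unit for
  all other leaves turns \<open>t\<close> into a left-normed monomial.\<close>

fun lword :: "nat set \<Rightarrow> tree \<Rightarrow> nat list option" where
  "lword S (Leaf i) = Some (if i \<in> S then [i] else [])"
| "lword S (Node l r) =
    Option.bind (lword S l) (\<lambda>xs. Option.bind (lword S r) (\<lambda>ys.
      if xs = [] then Some ys else if length ys \<le> 1 then Some (xs @ ys) else None))"

lemma lword_eq_filter: "lword S t = Some xs \<Longrightarrow> xs = filter (\<lambda>i. i \<in> S) (leaves t)"
proof (induction t arbitrary: xs)
  case (Node l r)
  then obtain ys zs where "lword S l = Some ys" "lword S r = Some zs" "xs = ys @ zs"
    by (auto simp: bind_eq_Some_conv split: if_splits)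
  then show ?case using Node.IH[of ys] Node.IH(2)[of zs] by simp
qed auto

lemma lword_short: "length (filter (\<lambda>i. i \<in> S) (leaves t)) \<le> 1 \<Longrightarrow> lword S t \<noteq> None"
proof (induction t)
  case (Node l r)
  then obtain xs ys where xy: "lword S l = Some xs" "lword S r = Some ys" by fastforce
  then have "length xs + length ys \<le> 1" using Node.prems lword_eq_filter by fastforce
  then show ?case using xy by simp
qed auto

lemma bprod_nonunit: "p \<noteq> U \<Longrightarrow> q \<noteq> U \<Longrightarrow> bprod k p q = Some r \<Longrightarrow> \<exists>i j. r = Z i j"
  by (cases "(k, p, q)" rule: bprod.cases) (auto split: if_splits)

lemma bprod_Z_right: "p \<noteq> U \<Longrightarrow> bprod k p (Z i j) = None"
  by (cases p) auto

lemma bprod_U_right [simp]: "bprod k p U = Some p"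
  by (cases p) auto

lemma walk_nonunit:
  "p \<noteq> U \<Longrightarrow> U \<notin> set qs \<Longrightarrow> walk k p qs = Some r \<Longrightarrow> r \<noteq> U \<and> (qs \<noteq> [] \<longrightarrow> (\<exists>i j. r = Z i j))"
proof (induction qs arbitrary: p)
  case (Cons q qs)
  then obtain p' where p': "bprod k p q = Some p'" "walk k p' qs = Some r"
    by (auto simp: bind_eq_Some_conv)
  obtain i j where "p' = Z i j" using bprod_nonunit[OF _ _ p'(1)] Cons.prems by auto
  then show ?case using Cons.IH[of p'] Cons.prems p'(2) by (cases qs) auto
qed simp

text \<open>A product of two nonunit basis elements is zero or some \<open>z\<close>, and a
  \<open>z\<close> to the right of a nonunit element gives zero. Hence, once the units are dropped,
  a right factor with two or more letters kills the monomial unless the left factor is a unit, and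
  what survives is a walk.\<close>

lemma beval_eq_walk:
  assumes "\<And>i. i \<in> set (leaves t) \<Longrightarrow> i \<in> S \<longleftrightarrow> \<psi> i \<noteq> U"
  shows "beval k \<psi> t = Option.bind (lword S t)
    (\<lambda>xs. case xs of [] \<Rightarrow> Some U | x # ys \<Rightarrow> walk k (\<psi> x) (map \<psi> ys))"
  using assms
proof (induction t)
  case (Leaf i)
  then show ?case by auto
next
  case (Node l r)
  have L: "beval k \<psi> l = Option.bind (lword S l) (\<lambda>xs. case xs of [] \<Rightarrow> Some U | x # ys \<Rightarrow> walk k (\<psi> x) (map \<psi> ys))"
    and R: "beval k \<psi> r = Option.bind (lword S r) (\<lambda>xs. case xs of [] \<Rightarrow> Some U | x # ys \<Rightarrow> walk k (\<psi> x) (map \<psi> ys))"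
    using Node by auto
  show ?case
  proof (cases "lword S l")
    case None
    then show ?thesis using L by simp
  next
    case l: (Some xs)
    show ?thesis
    proof (cases "lword S r")
      case None
      then show ?thesis using l R by (cases "beval k \<psi> l") auto
    next
      case r: (Some ys)
      have xs: "set xs \<subseteq> S \<inter> set (leaves l)" and ys: "set ys \<subseteq> S \<inter> set (leaves r)"
        using lword_eq_filter[OF l] lword_eq_filter[OF r] by auto
      have nU: "\<psi> i \<noteq> U" if "i \<in> set xs \<union> set ys" for i using that xs ys Node.prems[of i] by auto
      show ?thesis
      proof (cases xs)
        case Nil
        moreover have "bprod k U = Some" by auto
        ultimately show ?thesis using L R l r by (simp add: Option.bind_runit)
      next
        case (Cons x xs')
        note xc = this
        have bl: "beval k \<psi> l = walk k (\<psi> x) (map \<psi> xs')" using L l xc by simp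
        consider "ys = []" | y where "ys = [y]" | y z ys' where "ys = y # z # ys'"
          by (metis neq_Nil_conv)
        then show ?thesis
        proof cases
          case 1
          then show ?thesis using bl R l r xc by (cases "beval k \<psi> l") auto
        next
          case 2
          then show ?thesis using bl R l r xc by (cases "beval k \<psi> l") (auto simp: walk_append)
        next
          case 3
          have "Option.bind (beval k \<psi> l) (\<lambda>p. Option.bind (beval k \<psi> r) (\<lambda>q. bprod k p q)) = None"
          proof (rule ccontr)
            assume "\<not> ?thesis"
            then obtain p q where pq: "beval k \<psi> l = Some p" "beval k \<psi> r = Some q" "bprod k p q \<noteq> None"
              by (cases "beval k \<psi> l"; cases "beval k \<psi> r") auto
            have "p \<noteq> U" using walk_nonunit[of "\<psi> x" "map \<psi> xs'" k p] bl pq(1) xc nU by force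
            moreover have "\<exists>i j. q = Z i j"
              using walk_nonunit[of "\<psi> y" "map \<psi> (z # ys')" k q] R r 3 pq(2) nU by force
            ultimately show False using bprod_Z_right pq(3) by auto
          qed
          then show ?thesis using l r xc 3 by simp
        qed
      qed
    qed
  qed
qed

section \<open>Paths through the basis elements \<open>z\<close>\<close>

fun nxt :: "(nat \<Rightarrow> nat) \<Rightarrow> nat \<times> nat \<Rightarrow> nat \<times> nat" where
  "nxt k (i, j) = (if j < k i then (i, j + 1) else (i + 1, 1))"

text \<open>At each \<open>z\<close> exactly one letter continues the path: \<open>b\<close>, coded
  \<open>True\<close>, at the end of a block and \<open>a\<close> before it. So the path from a
  given start is deterministic.\<close>

fun pat :: "(nat \<Rightarrow> nat) \<Rightarrow> nat \<times> nat \<Rightarrow> nat \<Rightarrow> bool list" where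
  "pat k s 0 = []"
| "pat k s (Suc l) = (\<not> snd s < k (fst s)) # pat k (nxt k s) l"

lemma length_pat [simp]: "length (pat k s l) = l"
  by (induction l arbitrary: s) auto

definition state :: "(nat \<Rightarrow> nat) \<Rightarrow> nat \<times> nat \<Rightarrow> bool" where
  "state k s \<longleftrightarrow> 1 \<le> fst s \<and> 1 \<le> snd s \<and> snd s \<le> k (fst s)"

lemma state_nxt: "(\<And>i. 1 \<le> k i) \<Longrightarrow> state k s \<Longrightarrow> state k (nxt k s)"
  by (cases s) (auto simp: state_def)

definition letter :: "bool \<Rightarrow> bidx" where
  "letter b = (if b then Bb else Ba)"

lemma walk_Z:
  assumes k: "\<And>i. 1 \<le> k i" and "state k s" "U \<notin> set qs"
  shows "walk k (case_prod Z s) qs = Some c \<longleftrightarrow>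
    qs = map letter (pat k s (length qs)) \<and> c = case_prod Z ((nxt k ^^ length qs) s)"
  using assms(2,3)
proof (induction qs arbitrary: s)
  case Nil
  then show ?case by auto
next
  case (Cons q qs)
  obtain i j where s: "s = (i, j)" by (cases s)
  have st: "1 \<le> i" "1 \<le> j" "j \<le> k i" using Cons.prems s by (auto simp: state_def)
  have q: "q \<noteq> U" using Cons.prems by auto
  have b: "bprod k (Z i j) q = (if q = letter (\<not> j < k i) then Some (case_prod Z (nxt k s)) else None)"
    using st q s by (cases q) (auto simp: letter_def)
  have IH: "walk k (case_prod Z (nxt k s)) qs = Some c \<longleftrightarrow>
    qs = map letter (pat k (nxt k s) (length qs)) \<and> c = case_prod Z ((nxt k ^^ length qs) (nxt k s))"
    using Cons state_nxt[OF k] by auto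
  show ?case using b IH s by (auto simp: funpow_swap1 simp del: nxt.simps)
qed

lemma walk_letter: "p = Ba \<or> p = Bb \<Longrightarrow> q \<noteq> U \<Longrightarrow> walk k p (q # qs) = None"
  by (cases q) auto

section \<open>Bounds for the codimensions\<close>

definition pats :: "(nat \<Rightarrow> nat) \<Rightarrow> nat \<Rightarrow> bool list set" where
  "pats k l = {pat k s l | s. state k s}"

definition weight :: "bool list \<Rightarrow> nat" where
  "weight u = length (filter id u)"

lemma lword_Mon:
  assumes "t \<in> Mon n" "S \<subseteq> {1..n}" "lword S t = Some xs"
  shows "set xs = S" "distinct xs" "length xs = card S"
proof -
  have "xs = filter (\<lambda>i. i \<in> S) (leaves t)" using assms(3) by (rule lword_eq_filter)
  then show "set xs = S" "distinct xs" using assms(1,2) by (auto simp: Mon_def)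
  then show "length xs = card S" using distinct_card by fastforce
qed

text \<open>\<open>x\<close> is the variable replaced by some \<open>z\<close>, \<open>u\<close> the
  path pattern and \<open>T\<close> the set replaced by \<open>b\<close>. The starting point itself
  is not recorded, since starts with equal patterns give the same monomials.\<close>

definition match_trees :: "nat \<Rightarrow> nat set \<Rightarrow> nat \<times> bool list \<times> nat set \<Rightarrow> tree set" where
  "match_trees n S = (\<lambda>(x, u, T). {t \<in> Mon n. \<exists>ys. lword S t = Some (x # ys) \<and> map (\<lambda>y. y \<in> T) ys = u})"

text \<open>With two or more nonunit variables, all surviving monomials walk equally many steps from
  the same \<open>z\<close>, so their values coincide and the functional is determined by its
  support. With at most one nonunit variable every monomial survives, whence the alternative
  \<open>N = Mon n\<close>.\<close>

lemma nonzero_trees_of_basis_substitution: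
  assumes k: "\<And>i. 1 \<le> k i" and \<psi>: "\<And>i. valid_idx k (\<psi> i)"
    and S: "S = {i \<in> {1..n}. \<psi> i \<noteq> U}"
    and t0: "t0 \<in> Mon n" "beval k \<psi> t0 = Some c0"
  defines "N \<equiv> {t \<in> Mon n. beval k \<psi> t \<noteq> None}"
  shows "\<And>t c. t \<in> Mon n \<Longrightarrow> beval k \<psi> t = Some c \<Longrightarrow> c = c0"
    and "N = Mon n \<or> N \<in> match_trees n S `
      (S \<times> (SIGMA u:pats k (card S - 1). {T. T \<subseteq> S \<and> card T = weight u}))"
proof -
  let ?W = "\<lambda>xs. case xs of [] \<Rightarrow> Some U | x # ys \<Rightarrow> walk k (\<psi> x) (map \<psi> ys)"
  have ev: "beval k \<psi> t = Option.bind (lword S t) ?W" if "t \<in> Mon n" for t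
    using that by (intro beval_eq_walk) (auto simp: S Mon_def)
  have Sn: "S \<subseteq> {1..n}" by (auto simp: S)
  note lw = lword_Mon[OF _ Sn]
  obtain xs0 where xs0: "lword S t0 = Some xs0" "?W xs0 = Some c0"
    using t0 ev[OF t0(1)] by (auto simp: bind_eq_Some_conv)
  have "(\<forall>t c. t \<in> Mon n \<longrightarrow> beval k \<psi> t = Some c \<longrightarrow> c = c0) \<and>
    (N = Mon n \<or> N \<in> match_trees n S ` (S \<times> (SIGMA u:pats k (card S - 1). {T. T \<subseteq> S \<and> card T = weight u})))"
  proof (cases "card S \<le> 1")
    case True
    have "beval k \<psi> t = Some c0" if t: "t \<in> Mon n" for t
    proof -
      have "set (filter (\<lambda>i. i \<in> S) (leaves t)) = S" "distinct (filter (\<lambda>i. i \<in> S) (leaves t))"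
        using t Sn by (auto simp: Mon_def)
      then have "length (filter (\<lambda>i. i \<in> S) (leaves t)) \<le> 1" using True distinct_card by metis
      then obtain xs where xs: "lword S t = Some xs" using lword_short by blast
      have "length xs = length xs0" "set xs = set xs0" "length xs \<le> 1"
        using lw[OF t xs] lw[OF t0(1) xs0(1)] True by auto
      then have "xs = xs0" by (cases xs; cases xs0) auto
      then show ?thesis using ev[OF t] xs xs0 by simp
    qed
    then show ?thesis by (auto simp: N_def)
  next
    case False
    have long: "\<exists>x y ys. xs = x # y # ys" if "length xs = card S" for xs :: "nat list"
      using False that by (cases xs; cases "tl xs") auto
    obtain x0 ys0 where x0: "xs0 = x0 # ys0" "ys0 \<noteq> []" using long lw[OF t0(1) xs0(1)] by blast
    have nU: "\<psi> i \<noteq> U" if "i \<in> S" for i using that by (auto simp: S)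
    \<comment> \<open>Neither \<open>a\<close> nor \<open>b\<close> can be the first factor of a
      nonzero product of several nonunit elements.\<close>
    have startZ: "\<exists>s. state k s \<and> \<psi> x = case_prod Z s"
      if xy: "set (x # ys) = S" "ys \<noteq> []" "walk k (\<psi> x) (map \<psi> ys) \<noteq> None" for x ys
    proof -
      obtain y zs where ys: "ys = y # zs" using xy(2) by (cases ys) auto
      have "\<psi> x \<noteq> Ba" "\<psi> x \<noteq> Bb" using xy walk_letter[of "\<psi> x" "\<psi> y" k "map \<psi> zs"] nU[of y] ys by auto
      moreover have "\<psi> x \<noteq> U" using xy nU by auto
      ultimately obtain i j where "\<psi> x = Z i j" by (cases "\<psi> x") auto
      then show ?thesis using \<psi>[of x] by (intro exI[of _ "(i, j)"]) (auto simp: valid_idx_def state_def)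
    qed
    have set0: "set (x0 # ys0) = S" "distinct (x0 # ys0)" "length ys0 = card S - 1"
      using lw[OF t0(1) xs0(1)] x0 by auto
    have w0: "walk k (\<psi> x0) (map \<psi> ys0) = Some c0" using xs0 x0 by simp
    then obtain s where s: "state k s" "\<psi> x0 = case_prod Z s" using startZ set0 x0 by blast
    define u where "u = pat k s (card S - 1)"
    define T where "T = {y \<in> S. \<psi> y = Bb}"
    have walkS: "walk k (case_prod Z s) (map \<psi> ys) = Some c \<longleftrightarrow>
        map \<psi> ys = map letter u \<and> c = case_prod Z ((nxt k ^^ (card S - 1)) s)"
      if "set ys \<subseteq> S" "length ys = card S - 1" for ys c
    proof -
      have "U \<notin> set (map \<psi> ys)" using that(1) nU by fastforce
      from walk_Z[OF k s(1) this] show ?thesis using that by (simp add: u_def)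
    qed
    have c0: "map \<psi> ys0 = map letter u" "c0 = case_prod Z ((nxt k ^^ (card S - 1)) s)"
      using walkS[of ys0 c0] w0 s set0 by auto
    \<comment> \<open>Since \<open>t0\<close> survives, every variable of \<open>S\<close> other
      than \<open>x0\<close> is sent to \<open>a\<close> or \<open>b\<close>; therefore each
      surviving monomial must begin with \<open>x0\<close>.\<close>
    have let0: "\<psi> y = letter (y \<in> T)" if y: "y \<in> S - {x0}" for y
    proof -
      have "\<psi> y \<in> set (map \<psi> ys0)" using y set0 by auto
      then show ?thesis using y unfolding c0 by (auto simp: letter_def T_def split: if_splits)
    qed
    have nletter: "\<psi> x0 \<noteq> letter b" for b using s by (cases s) (auto simp: letter_def)
    have pattern: "map (\<lambda>y. y \<in> T) ys = u \<longleftrightarrow> map \<psi> ys = map letter u" if ys: "set ys \<subseteq> S - {x0}" for ys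
    proof -
      have "inj letter" by (auto simp: inj_def letter_def)
      moreover have "map \<psi> ys = map letter (map (\<lambda>y. y \<in> T) ys)" using ys let0 by auto
      ultimately show ?thesis by (metis inj_map_eq_map)
    qed
    have key: "beval k \<psi> t = Some c \<longleftrightarrow>
        c = c0 \<and> (\<exists>ys. lword S t = Some (x0 # ys) \<and> map (\<lambda>y. y \<in> T) ys = u)" if t: "t \<in> Mon n" for t c
    proof
      assume c: "beval k \<psi> t = Some c"
      then obtain xs where xs: "lword S t = Some xs" "?W xs = Some c"
        using ev[OF t] by (auto simp: bind_eq_Some_conv)
      obtain x ys where x: "xs = x # ys" "ys \<noteq> []" using long lw[OF t xs(1)] by blast
      have w: "walk k (\<psi> x) (map \<psi> ys) = Some c" using xs x by simp
      have set: "set (x # ys) = S" "distinct (x # ys)" "length ys = card S - 1"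
        using lw[OF t xs(1)] x by auto
      then obtain s' where "\<psi> x = case_prod Z s'" using startZ[of x ys] x w by auto
      then have "\<psi> x \<noteq> letter b" for b by (cases s') (auto simp: letter_def)
      then have "x = x0" using let0[of x] set by auto
      then show "c = c0 \<and> (\<exists>ys. lword S t = Some (x0 # ys) \<and> map (\<lambda>y. y \<in> T) ys = u)"
        using walkS[of ys c] w s set xs x pattern[of ys] c0 by auto
    next
      assume r: "c = c0 \<and> (\<exists>ys. lword S t = Some (x0 # ys) \<and> map (\<lambda>y. y \<in> T) ys = u)"
      then obtain ys where ys: "lword S t = Some (x0 # ys)" "map (\<lambda>y. y \<in> T) ys = u" by blast
      have set: "set (x0 # ys) = S" "distinct (x0 # ys)" "length ys = card S - 1"
        using lw[OF t ys(1)] by auto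
      then have "walk k (\<psi> x0) (map \<psi> ys) = Some c"
        using walkS[of ys c] pattern[of ys] ys r c0 s by auto
      then show "beval k \<psi> t = Some c" using ev[OF t] ys by simp
    qed
    have "x0 \<notin> T" using nletter[of True] by (auto simp: T_def letter_def)
    then have "T = set (filter (\<lambda>y. y \<in> T) ys0)" using set0 by (auto simp: T_def)
    then have "card T = length (filter (\<lambda>y. y \<in> T) ys0)"
      using distinct_card[of "filter (\<lambda>y. y \<in> T) ys0"] set0 by simp
    also have "\<dots> = weight (map (\<lambda>y. y \<in> T) ys0)" by (simp add: weight_def filter_map o_def)
    also have "map (\<lambda>y. y \<in> T) ys0 = u" using pattern[of ys0] set0 c0 by auto
    finally have "card T = weight u" .
    moreover have "N = match_trees n S (x0, u, T)"
      using key by (auto simp: N_def match_trees_def)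
    moreover have "u \<in> pats k (card S - 1)" using s(1) unfolding pats_def u_def by blast
    moreover have "x0 \<in> S" "T \<subseteq> S" using set0 by (auto simp: T_def)
    ultimately have "N \<in> match_trees n S ` (S \<times> (SIGMA u:pats k (card S - 1). {T. T \<subseteq> S \<and> card T = weight u}))"
      by auto
    then show ?thesis using key by auto
  qed
  then show "\<And>t c. t \<in> Mon n \<Longrightarrow> beval k \<psi> t = Some c \<Longrightarrow> c = c0"
    and "N = Mon n \<or> N \<in> match_trees n S `
      (S \<times> (SIGMA u:pats k (card S - 1). {T. T \<subseteq> S \<and> card T = weight u}))" by auto
qed

text \<open>\<open>\<S>\<close> contains the possible sets of nonunit variables and \<open>V\<close>
  the basis in use, so that both algebras are covered. The summand 1 counts the support
  \<open>Mon n\<close>. Letting \<open>T\<close> range over subsets of all of \<open>S\<close>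
  overcounts harmlessly.\<close>

lemma codim_le_sum:
  assumes k: "\<And>i. 1 \<le> k i" and V: "V \<noteq> {}" "\<And>p. p \<in> V \<Longrightarrow> valid_idx k p"
    and fin: "\<And>l. finite (pats k l)"
    and \<S>: "finite \<S>" "\<And>S. S \<in> \<S> \<Longrightarrow> S \<subseteq> {1..n}"
    and supp: "\<And>\<psi> :: nat \<Rightarrow> bidx. range \<psi> \<subseteq> V \<Longrightarrow> {i \<in> {1..n}. \<psi> i \<noteq> U} \<in> \<S>"
  shows "codim n (amult k) {x :: bidx \<Rightarrow> 'f::field. finite (supp x) \<and> supp x \<subseteq> V}
    \<le> 1 + (\<Sum>S\<in>\<S>. card S * (\<Sum>u\<in>pats k (card S - 1). card S choose weight u))"
proof -
  let ?K = "\<lambda>S. S \<times> (SIGMA u:pats k (card S - 1). {T. T \<subseteq> S \<and> card T = weight u})"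
  define \<N> where "\<N> = {Mon n} \<union> (\<Union>S\<in>\<S>. match_trees n S ` ?K S)"
  have finS: "finite S" if "S \<in> \<S>" for S using \<S>(2)[OF that] finite_subset by blast
  have finK: "finite (?K S)" if "S \<in> \<S>" for S
    using finS[OF that] fin by (intro finite_SigmaI finite_cartesian_product) (auto simp: finite_Collect_subsets)
  have "finite \<N>" using finK \<S>(1) by (auto simp: \<N>_def)
  have "codim n (amult k) {x :: bidx \<Rightarrow> 'f. finite (supp x) \<and> supp x \<subseteq> V} \<le> card \<N>"
  proof (rule codim_le_card[OF \<open>finite \<N>\<close>])
    fix f :: "tree \<Rightarrow> 'f" assume f: "\<forall>N\<in>\<N>. (\<Sum>t\<in>N. f t) = 0"
    show "is_identity (amult k) {x. finite (supp x) \<and> supp x \<subseteq> V} n f"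
    proof (rule is_identity_if_basis[OF V(1)])
      fix \<psi> :: "nat \<Rightarrow> bidx" and c assume \<psi>: "range \<psi> \<subseteq> V"
      have "(\<Sum>t\<in>Mon n. f t * teval (amult k) (\<lambda>i. bvec (\<psi> i)) t c) = (\<Sum>t\<in>Mon n. if beval k \<psi> t = Some c then f t else 0)"
        unfolding teval_bvec by (intro sum.cong) auto
      also have "\<dots> = (\<Sum>t\<in>{t \<in> Mon n. beval k \<psi> t = Some c}. f t)"
        by (simp add: sum.inter_filter)
      also have "\<dots> = 0"
      proof (cases "\<exists>t0\<in>Mon n. beval k \<psi> t0 = Some c")
        case True
        then obtain t0 where t0: "t0 \<in> Mon n" "beval k \<psi> t0 = Some c" by blast
        have v: "valid_idx k (\<psi> i)" for i using \<psi> V(2) by auto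
        note nz = nonzero_trees_of_basis_substitution[OF k v refl t0]
        have "beval k \<psi> t = Some c \<longleftrightarrow> beval k \<psi> t \<noteq> None" if "t \<in> Mon n" for t
          using nz(1)[OF that] by (cases "beval k \<psi> t") auto
        then have "{t \<in> Mon n. beval k \<psi> t = Some c} = {t \<in> Mon n. beval k \<psi> t \<noteq> None}"
          by (rule Collect_cong[OF conj_cong[OF refl]])
        also from nz(2) have "\<dots> \<in> \<N>"
        proof
          assume "{t \<in> Mon n. beval k \<psi> t \<noteq> None} = Mon n"
          then show ?thesis by (simp only: \<N>_def UnI1 singletonI)
        qed (unfold \<N>_def, rule UnI2, rule UN_I[OF supp[OF \<psi>]])
        finally show ?thesis using f by blast
      next
        case False
        then have "{t \<in> Mon n. beval k \<psi> t = Some c} = {}" by auto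
        then show ?thesis by (simp only: sum.empty)
      qed
      finally show "(\<Sum>t\<in>Mon n. f t * teval (amult k) (\<lambda>i. bvec (\<psi> i)) t c) = 0" .
    qed
  qed
  also have "card \<N> \<le> 1 + card (\<Union>S\<in>\<S>. match_trees n S ` ?K S)"
    unfolding \<N>_def using card_Un_le[of "{Mon n}"] by simp
  also have "card (\<Union>S\<in>\<S>. match_trees n S ` ?K S) \<le> (\<Sum>S\<in>\<S>. card (match_trees n S ` ?K S))"
    using \<S>(1) by (rule card_UN_le)
  also have "\<dots> \<le> (\<Sum>S\<in>\<S>. card S * (\<Sum>u\<in>pats k (card S - 1). card S choose weight u))"
  proof (rule sum_mono)
    fix S assume S: "S \<in> \<S>"
    have "card (match_trees n S ` ?K S) \<le> card (?K S)" by (rule card_image_le[OF finK[OF S]])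
    also have "\<dots> = card S * (\<Sum>u\<in>pats k (card S - 1). card {T. T \<subseteq> S \<and> card T = weight u})"
      using fin finS[OF S] by (subst card_cartesian_product, subst card_SigmaI) auto
    finally show "card (match_trees n S ` ?K S) \<le> card S * (\<Sum>u\<in>pats k (card S - 1). card S choose weight u)"
      using finS[OF S] by (simp add: n_subsets)
  qed
  finally show ?thesis by simp
qed

section \<open>Lower bound: monomials that separate the functionals\<close>

lemma arrange_by_pattern:
  assumes "finite A" "finite B" "A \<inter> B = {}" "card B = weight u" "card A + card B = length u"
  shows "\<exists>ys. distinct ys \<and> set ys = A \<union> B \<and> map (\<lambda>y. y \<in> B) ys = u"
  using assms
proof (induction u arbitrary: A B)
  case Nil
  then show ?case by auto
next
  case (Cons b u)
  show ?case
  proof (cases b)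
    case True
    then have "card B \<noteq> 0" using Cons.prems by (simp add: weight_def)
    then obtain x where x: "x \<in> B" by fastforce
    then obtain ys where ys: "distinct ys" "set ys = A \<union> (B - {x})" "map (\<lambda>y. y \<in> B - {x}) ys = u"
      using Cons.IH[of A "B - {x}"] Cons.prems True by (auto simp: weight_def)
    have "x \<notin> set ys" using ys x Cons.prems by auto
    then have "map (\<lambda>y. y \<in> B) ys = map (\<lambda>y. y \<in> B - {x}) ys" by (intro map_cong) auto
    then have "map (\<lambda>y. y \<in> B) ys = u" using ys(3) by (rule trans)
    then show ?thesis using ys \<open>x \<notin> set ys\<close> x True by (intro exI[of _ "x # ys"]) auto
  next
    case False
    then have "card A \<noteq> 0"
      using Cons.prems length_filter_le[of id u] by (auto simp: weight_def simp del: length_filter_le)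
    then obtain x where x: "x \<in> A" by fastforce
    have "card (A - {x}) = card A - 1" using x Cons.prems by simp
    then obtain ys where ys: "distinct ys" "set ys = (A - {x}) \<union> B" "map (\<lambda>y. y \<in> B) ys = u"
      using Cons.IH[of "A - {x}" B] Cons.prems False \<open>card A \<noteq> 0\<close> by (auto simp: weight_def)
    have "x \<notin> set ys" "x \<notin> B" using ys x Cons.prems by auto
    then show ?thesis using ys x False by (intro exI[of _ "x # ys"]) auto
  qed
qed

definition lcomb :: "nat \<Rightarrow> nat list \<Rightarrow> tree" where
  "lcomb x ys = foldl (\<lambda>t y. Node t (Leaf y)) (Leaf x) ys"

fun rcomb :: "nat \<Rightarrow> nat list \<Rightarrow> tree" where
  "rcomb x [] = Leaf x"
| "rcomb x (y # ys) = Node (Leaf x) (rcomb y ys)"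

lemma leaves_lcomb [simp]: "leaves (lcomb x ys) = x # ys"
  unfolding lcomb_def by (induction ys rule: rev_induct) auto

lemma leaves_rcomb [simp]: "leaves (rcomb x ys) = x # ys"
  by (induction ys arbitrary: x) auto

lemma lword_lcomb: "lword S (lcomb x ys) = Some (filter (\<lambda>i. i \<in> S) (x # ys))"
  unfolding lcomb_def by (induction ys rule: rev_induct) auto

text \<open>The first selected leaf is multiplied by a right factor that contains at least two
  further selected leaves.\<close>

lemma lword_rcomb_None: "3 \<le> length (filter (\<lambda>i. i \<in> S) (x # ys)) \<Longrightarrow> lword S (rcomb x ys) = None"
proof (induction ys arbitrary: x)
  case (Cons y ys)
  show ?case
  proof (cases "x \<in> S")
    case False
    then have "lword S (rcomb y ys) = None" using Cons.prems by (intro Cons.IH) (auto split: if_splits)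
    then show ?thesis by simp
  next
    case True
    then have "2 \<le> length (filter (\<lambda>i. i \<in> S) (y # ys))" using Cons.prems by (auto split: if_splits)
    then show ?thesis using True
      by (cases "lword S (rcomb y ys)") (auto dest: lword_eq_filter split: if_splits)
  qed
qed (auto split: if_splits)

text \<open>The right-normed left factor, which carries the variables to be replaced by the unit, makes the
  monomial vanish under every other choice of the same number of nonunit variables.\<close>

lemma exists_selecting_tree:
  assumes S: "S \<subseteq> {1..n}" and T: "T \<subseteq> S - {x}" "card T = weight u" and x: "x \<in> S"
    and u: "length u = card S - 1" and l: "4 \<le> card S \<or> S = {1..n}"
  shows "\<exists>t\<in>Mon n. (\<exists>ys. lword S t = Some (x # ys) \<and> map (\<lambda>y. y \<in> T) ys = u) \<and>
    (\<forall>S'\<subseteq>{1..n}. card S' = card S \<longrightarrow> S' \<noteq> S \<longrightarrow> lword S' t = None)"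
proof -
  have fin: "finite S" using S finite_subset by blast
  have "\<exists>ys. distinct ys \<and> set ys = (S - {x} - T) \<union> T \<and> map (\<lambda>y. y \<in> T) ys = u"
  proof (rule arrange_by_pattern)
    have "finite T" using T fin finite_subset by blast
    moreover have "card T \<le> card (S - {x})" using T fin by (intro card_mono) auto
    ultimately show "card (S - {x} - T) + card T = length u"
      using T fin x u by (simp add: card_Diff_subset)
  qed (use T fin finite_subset in auto)
  then obtain ys where ys: "distinct ys" "set ys = S - {x}" "map (\<lambda>y. y \<in> T) ys = u"
    using T by (auto simp: Un_absorb2)
  have lw: "lword S (lcomb x ys) = Some (x # ys)"
    using ys x by (auto simp: lword_lcomb)
  have setS: "set (x # ys) = S" "distinct (x # ys)" using ys x by auto
  show ?thesis
  proof (cases "S = {1..n}")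
    case True
    have "S' = S" if "S' \<subseteq> {1..n}" "card S' = card S" for S'
      using that True by (simp add: card_subset_eq)
    moreover have "lcomb x ys \<in> Mon n" using setS True by (simp add: Mon_def)
    ultimately show ?thesis using lw ys by blast
  next
    case False
    then have "{1..n} - S \<noteq> {}" using S by auto
    then obtain z zs where z: "set (z # zs) = {1..n} - S" "distinct (z # zs)"
      by (metis finite_Diff finite_atLeastAtMost finite_distinct_list neq_Nil_conv set_empty)
    let ?t = "Node (rcomb z zs) (lcomb x ys)"
    have "\<forall>i\<in>set (z # zs). i \<notin> S" using z(1) by blast
    then have empty: "filter (\<lambda>i. i \<in> S) (z # zs) = []" by (simp only: filter_empty_conv)
    then have "length (filter (\<lambda>i. i \<in> S) (leaves (rcomb z zs))) \<le> 1" by (simp only: leaves_rcomb list.size)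
    then obtain vs where vs: "lword S (rcomb z zs) = Some vs"
      using lword_short[of S "rcomb z zs"] by blast
    then have "vs = []" using lword_eq_filter[OF vs] empty by (simp only: leaves_rcomb)
    then have "lword S ?t = Some (x # ys)" using vs lw by simp
    moreover have "?t \<in> Mon n" using z setS S by (auto simp: Mon_def)
    moreover have "lword S' ?t = None" if S': "S' \<subseteq> {1..n}" "card S' = card S" "S' \<noteq> S" for S'
    proof (rule ccontr)
      assume "lword S' ?t \<noteq> None"
      then obtain vs where vs: "lword S' (rcomb z zs) = Some vs"
        and r: "vs = [] \<or> length (filter (\<lambda>i. i \<in> S') (x # ys)) \<le> 1"
        by (cases "lword S' (rcomb z zs)") (auto simp: lword_lcomb simp del: filter.simps split: if_splits)
      have vf: "vs = filter (\<lambda>i. i \<in> S') (z # zs)" using lword_eq_filter[OF vs] by simp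
      have fin': "finite S'" using S' finite_subset by blast
      have sv: "set vs = S' - S" "distinct vs" using vf z S' by auto
      have "length (filter (\<lambda>i. i \<in> S') (x # ys)) = card (set (filter (\<lambda>i. i \<in> S') (x # ys)))"
        using setS(2) by (metis distinct_card distinct_filter)
      also have "set (filter (\<lambda>i. i \<in> S') (x # ys)) = S' \<inter> S" using setS(1) by auto
      finally have li: "length (filter (\<lambda>i. i \<in> S') (x # ys)) = card (S' \<inter> S)" .
      have "card S' = card (S' - S) + card (S' \<inter> S)"
        using fin' by (metis Diff_Int_distrib card_Diff_subset_Int add.commute card_Int_Diff)
      moreover have "S' - S \<noteq> {}" using S' fin fin' by (metis Diff_eq_empty_iff card_subset_eq)
      then have "vs \<noteq> []" using sv by auto
      moreover have "card (S' - S) = length vs" using sv distinct_card by fastforce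
      moreover have "\<not> 3 \<le> length vs" using lword_rcomb_None[of S' z zs] vs vf by auto
      \<comment> \<open>As \<open>vs\<close> is nonempty, \<open>S'\<close> meets \<open>S\<close>
        in at most one element, while the right-normed factor tolerates at most two selected leaves;
        thus \<open>card S' \<le> 3\<close>, which the bound 4 excludes.\<close>
      ultimately show False using r li l False S'(2) by linarith
    qed
    ultimately show ?thesis using ys(3) by blast
  qed
qed

text \<open>The start \<open>s\<close> is fixed and \<open>Min S\<close> is a canonical first
  variable, so the functionals are indexed by \<open>S\<close> and the set \<open>T\<close> sent to
  \<open>b\<close>. The selecting trees separate sets of equal size, hence the fixed
  \<open>l\<close>. For \<open>l = n\<close> no unit is substituted, which serves \<open>A\<close>
  itself.\<close>

lemma codim_ge_binomials:
  assumes k: "\<And>i. 1 \<le> k i" and s: "state k s"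
    and V: "case_prod Z s \<in> V" "Ba \<in> V" "Bb \<in> V" "l = n \<or> U \<in> V"
    and l: "1 \<le> l" "l = n \<or> 4 \<le> l"
  shows "(n choose l) * ((l - 1) choose weight (pat k s (l - 1)))
    \<le> codim n (amult k) {x :: bidx \<Rightarrow> 'f::field. finite (supp x) \<and> supp x \<subseteq> V}"
proof -
  define u where "u = pat k s (l - 1)"
  define I where "I = (SIGMA S:{S. S \<subseteq> {1..n} \<and> card S = l}. {T. T \<subseteq> S - {Min S} \<and> card T = weight u})"
  \<comment> \<open>Indices outside \<open>{1..n}\<close> receive \<open>a\<close>, because
    \<open>V\<close> need not contain the unit when \<open>l = n\<close>.\<close>
  define \<psi> where "\<psi> = (\<lambda>(S, T) y. if y = Min S then case_prod Z s else if y \<in> T then Bb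
    else if y \<in> {1..n} - S then U else Ba)"
  have fin: "finite S" if "S \<subseteq> {1..n}" for S using that finite_subset by blast
  have finI: "finite I" unfolding I_def using fin by (intro finite_SigmaI) auto
  have full: "S = {1..n}" if "S \<subseteq> {1..n}" "card S = n" for S using that by (simp add: card_subset_eq)
  have mem: "S \<subseteq> {1..n}" "card S = l" "S \<noteq> {}" "Min S \<in> S" "T \<subseteq> S - {Min S}" "card T = weight u"
    if ST: "(S, T) \<in> I" for S T
  proof -
    show "S \<subseteq> {1..n}" "card S = l" "T \<subseteq> S - {Min S}" "card T = weight u"
      using ST by (auto simp: I_def)
    then show "S \<noteq> {}" using l by auto
    then show "Min S \<in> S" using fin[OF \<open>S \<subseteq> {1..n}\<close>] by (intro Min_in)
  qed
  have "card I = (\<Sum>S\<in>{S. S \<subseteq> {1..n} \<and> card S = l}. (l - 1) choose weight u)"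
  proof -
    have "card I = (\<Sum>S\<in>{S. S \<subseteq> {1..n} \<and> card S = l}. card {T. T \<subseteq> S - {Min S} \<and> card T = weight u})"
      unfolding I_def using fin by (intro card_SigmaI) auto
    also have "\<dots> = (\<Sum>S\<in>{S. S \<subseteq> {1..n} \<and> card S = l}. (l - 1) choose weight u)"
    proof (intro sum.cong refl)
      fix S assume "S \<in> {S. S \<subseteq> {1..n} \<and> card S = l}"
      then have S: "finite S" "card S = l" using fin by auto
      then have "Min S \<in> S" using l by (intro Min_in) auto
      then show "card {T. T \<subseteq> S - {Min S} \<and> card T = weight u} = (l - 1) choose weight u"
        using S by (subst n_subsets) auto
    qed
    finally show ?thesis .
  qed
  then have cardI: "card I = (n choose l) * ((l - 1) choose weight u)"
    using n_subsets[of "{1..n}" l] by simp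
  have "\<forall>i\<in>I. \<exists>t. t \<in> Mon n \<and> (\<exists>ys. lword (fst i) t = Some (Min (fst i) # ys) \<and> map (\<lambda>y. y \<in> snd i) ys = u) \<and>
    (\<forall>S'\<subseteq>{1..n}. card S' = card (fst i) \<longrightarrow> S' \<noteq> fst i \<longrightarrow> lword S' t = None)"
  proof
    fix i assume i: "i \<in> I"
    obtain S T where ST: "i = (S, T)" by (cases i)
    note m = mem[OF i[unfolded ST]]
    have "\<exists>t\<in>Mon n. (\<exists>ys. lword S t = Some (Min S # ys) \<and> map (\<lambda>y. y \<in> T) ys = u) \<and>
    (\<forall>S'\<subseteq>{1..n}. card S' = card S \<longrightarrow> S' \<noteq> S \<longrightarrow> lword S' t = None)"
    proof (rule exists_selecting_tree)
      show "length u = card S - 1" using m by (simp add: u_def)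
      show "4 \<le> card S \<or> S = {1..n}" using m l full by auto
    qed (use m in auto)
    then show "\<exists>t. t \<in> Mon n \<and> (\<exists>ys. lword (fst i) t = Some (Min (fst i) # ys) \<and> map (\<lambda>y. y \<in> snd i) ys = u) \<and>
    (\<forall>S'\<subseteq>{1..n}. card S' = card (fst i) \<longrightarrow> S' \<noteq> fst i \<longrightarrow> lword S' t = None)"
      unfolding ST by auto
  qed
  from bchoice[OF this] obtain t where t: "\<forall>i\<in>I. t i \<in> Mon n \<and>
    (\<exists>ys. lword (fst i) (t i) = Some (Min (fst i) # ys) \<and> map (\<lambda>y. y \<in> snd i) ys = u) \<and>
    (\<forall>S'\<subseteq>{1..n}. card S' = card (fst i) \<longrightarrow> S' \<noteq> fst i \<longrightarrow> lword S' (t i) = None)" by blast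
  define c where "c = case_prod Z ((nxt k ^^ (l - 1)) s)"
  have sU: "case_prod Z s \<noteq> U" by (cases s) auto
  have delta: "beval k (\<psi> i) (t j) = Some c \<longleftrightarrow> i = j" if ij: "i \<in> I" "j \<in> I" for i j
  proof -
    obtain S T S' T' where ST: "i = (S, T)" "j = (S', T')" by (cases i; cases j)
    note m = mem[OF ij(1)[unfolded ST]] and m' = mem[OF ij(2)[unfolded ST]]
    have tj: "t j \<in> Mon n" using t ij by blast
    have "y \<in> S \<longleftrightarrow> \<psi> i y \<noteq> U" if "y \<in> {1..n}" for y
      using that m sU by (auto simp: \<psi>_def ST)
    then have ev: "beval k (\<psi> i) (t j) = Option.bind (lword S (t j))
        (\<lambda>xs. case xs of [] \<Rightarrow> Some U | x # ys \<Rightarrow> walk k (\<psi> i x) (map (\<psi> i) ys))"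
      using tj by (intro beval_eq_walk) (auto simp: Mon_def)
    show ?thesis
    proof (cases "S = S'")
      case False
      then have "lword S (t j) = None" using t ij m m' ST by auto
      then show ?thesis using ev False ST by auto
    next
      case True
      obtain ys where ys: "lword S (t j) = Some (Min S # ys)" "map (\<lambda>y. y \<in> T') ys = u"
        using t ij ST True by force
      have lw: "set (Min S # ys) = S" "distinct (Min S # ys)" "length (Min S # ys) = card S"
        using lword_Mon[OF tj m(1) ys(1)] .
      have \<psi>ys: "map (\<psi> i) ys = map letter (map (\<lambda>y. y \<in> T) ys)"
        using lw by (auto simp: \<psi>_def ST letter_def)
      have len: "length ys = l - 1" using lw m by simp
      have "beval k (\<psi> i) (t j) = walk k (case_prod Z s) (map (\<psi> i) ys)"
        using ev ys by (simp add: \<psi>_def ST)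
      also have "\<dots> = Some c \<longleftrightarrow> map (\<psi> i) ys = map letter u \<and> c = case_prod Z ((nxt k ^^ (l - 1)) s)"
      proof -
        have "U \<notin> set (map (\<psi> i) ys)" unfolding \<psi>ys by (auto simp: letter_def split: if_splits)
        from walk_Z[OF k s this] show ?thesis using len by (simp add: u_def)
      qed
      also have "\<dots> \<longleftrightarrow> map (\<lambda>y. y \<in> T) ys = u"
      proof -
        have "inj letter" by (auto simp: inj_def letter_def)
        then show ?thesis unfolding \<psi>ys c_def by (simp add: inj_map_eq_map del: map_map)
      qed
      also have "\<dots> \<longleftrightarrow> T = T'"
      proof
        assume "map (\<lambda>y. y \<in> T) ys = u"
        then have "\<forall>y\<in>set ys. y \<in> T \<longleftrightarrow> y \<in> T'" using ys(2) by (metis (no_types, lifting) map_eq_conv)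
        moreover have "set ys = S - {Min S}" using lw by auto
        ultimately show "T = T'" using m m' True by blast
      qed (use ys in simp)
      finally show ?thesis using ST True by simp
    qed
  qed
  have "card I \<le> codim n (amult k) {x :: bidx \<Rightarrow> 'f. finite (supp x) \<and> supp x \<subseteq> V}"
  proof (rule card_le_codim[where t = t and \<phi> = "\<lambda>i y. bvec (\<psi> i y)" and c = "\<lambda>_. c"])
    fix i y assume i: "i \<in> I"
    obtain S T where ST: "i = (S, T)" by (cases i)
    have "U \<in> V \<or> S = {1..n}" using V(4) mem[OF i[unfolded ST]] full by auto
    then have "\<psi> i y \<in> V" using V by (auto simp: \<psi>_def ST)
    then show "bvec (\<psi> i y) \<in> {x :: bidx \<Rightarrow> 'f. finite (supp x) \<and> supp x \<subseteq> V}" by simp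
  next
    fix i j assume "i \<in> I" "j \<in> I"
    then show "teval (amult k) (\<lambda>y. bvec (\<psi> i y)) (t j) c = (if i = j then 1 else 0 :: 'f)"
      using delta by (simp add: teval_bvec)
  qed (use t finI in auto)
  then show ?thesis using cardI by (simp add: u_def)
qed

section \<open>The PI-exponents\<close>

lemma pat_cong:
  "(\<And>d. d \<le> l \<Longrightarrow> k (i + d) = k' (i' + d)) \<Longrightarrow> pat k (i, j) l = pat k' (i', j) l"
proof (induction l arbitrary: i i' j)
  case (Suc l)
  have e: "k i = k' i'" using Suc.prems[of 0] by simp
  have "pat k (i, Suc j) l = pat k' (i', Suc j) l" by (rule Suc.IH) (use Suc.prems in auto)
  moreover have "pat k (Suc i, Suc 0) l = pat k' (Suc i', Suc 0) l"
    by (rule Suc.IH) (use Suc.prems[of "Suc _"] in auto)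
  ultimately show ?case using e by simp
qed simp

text \<open>A path of \<open>l\<close> steps meets at most \<open>l + 1\<close> consecutive blocks,
  so its pattern is determined by the starting offset, at most \<open>m + 1\<close>, and a subword
  of length \<open>l + 1\<close>.\<close>

lemma pats_bound:
  assumes bin: "\<forall>i\<ge>1. w i \<in> {0, 1}" and fin: "finite (subwords w (Suc l))"
  shows "finite (pats (kseq m w) l)" "card (pats (kseq m w) l) \<le> (m + 1) * card (subwords w (Suc l))"
proof -
  let ?f = "\<lambda>(j, v). pat (\<lambda>i. m + v ! i) (0, j) l"
  have sub: "pats (kseq m w) l \<subseteq> ?f ` ({1..m + 1} \<times> subwords w (Suc l))"
  proof
    fix u assume "u \<in> pats (kseq m w) l"
    then obtain i j where u: "u = pat (kseq m w) (i, j) l" and st: "state (kseq m w) (i, j)"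
      by (auto simp: pats_def)
    have "1 \<le> i" "1 \<le> j" "j \<le> m + w i" using st by (auto simp: state_def kseq_def)
    moreover have "w i \<le> 1" using bin \<open>1 \<le> i\<close> by auto
    moreover have "u = ?f (j, map w [i..<i + Suc l])"
      unfolding u prod.case by (rule pat_cong) (simp add: kseq_def del: upt_Suc)
    moreover have "map w [i..<i + Suc l] \<in> subwords w (Suc l)"
      using \<open>1 \<le> i\<close> unfolding subwords_def by blast
    ultimately show "u \<in> ?f ` ({1..m + 1} \<times> subwords w (Suc l))"
      by (intro image_eqI[of _ _ "(j, map w [i..<i + Suc l])"]) auto
  qed
  have f: "finite ({1..m + 1} \<times> subwords w (Suc l))" using fin by simp
  show "finite (pats (kseq m w) l)" using finite_subset[OF sub finite_imageI[OF f]] .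
  have "card (pats (kseq m w) l) \<le> card ({1..m + 1} \<times> subwords w (Suc l))"
    using surj_card_le[OF f sub] .
  then show "card (pats (kseq m w) l) \<le> (m + 1) * card (subwords w (Suc l))"
    by (simp add: card_cartesian_product)
qed

text \<open>Every letter \<open>b\<close> closes a block. Measured from the beginning of block
  \<open>i\<close>, the path ends at position \<open>l + j\<close>, which is the total length of the
  closed blocks plus the offset \<open>j'\<close> in the current one.\<close>

lemma length_eq_block_sum:
  assumes "\<And>i. 1 \<le> k i" "state k (i, j)"
  shows "\<exists>j'. 1 \<le> j' \<and> j' \<le> k (i + weight (pat k (i, j) l)) \<and>
    l + j = (\<Sum>r<weight (pat k (i, j) l). k (i + r)) + j'"
  using assms(2)
proof (induction l arbitrary: i j)
  case 0
  then show ?case by (auto simp: state_def weight_def)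
next
  case (Suc l)
  have st: "state k (nxt k (i, j))" using state_nxt[OF assms(1) Suc.prems] .
  show ?case
  proof (cases "j < k i")
    case True
    then have w: "weight (pat k (i, j) (Suc l)) = weight (pat k (i, Suc j) l)" by (simp add: weight_def)
    show ?thesis using Suc.IH[of i "Suc j"] st True unfolding w by simp
  next
    case False
    then have j: "j = k i" using Suc.prems by (auto simp: state_def)
    let ?t = "weight (pat k (Suc i, 1) l)"
    have w: "weight (pat k (i, j) (Suc l)) = Suc ?t" using False by (simp add: weight_def)
    obtain j' where j': "1 \<le> j'" "j' \<le> k (Suc i + ?t)" "l + 1 = (\<Sum>r<?t. k (Suc i + r)) + j'"
      using Suc.IH[of "Suc i" 1] st False by auto
    then have "Suc l + j = (\<Sum>r<Suc ?t. k (i + r)) + j'"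
      unfolding sum.lessThan_Suc_shift using j by simp
    then show ?thesis unfolding w using j' by (intro exI[of _ j']) auto
  qed
qed

lemma weight_pat_le: "weight (pat k s l) \<le> l"
  unfolding weight_def using length_filter_le[of id "pat k s l"] by simp

text \<open>A path of \<open>l\<close> steps containing \<open>t\<close> letters \<open>b\<close> runs through \<open>t\<close> blocks, of total length
  \<open>m t + w\<^sub>i + \<dots> + w\<^bsub>i+t-1\<^esub>\<close>, up to a bounded error.\<close>

lemma weight_pat_deviation:
  fixes m :: nat
  assumes m: "1 \<le> m" and bin: "\<forall>i\<ge>1. w i \<in> {0, 1}"
    and C: "\<And>p L. p \<ge> 1 \<Longrightarrow> \<bar>int (fsum w p L) - int (fsum w 1 L)\<bar> \<le> int C"
    and lim: "(\<lambda>n. (\<Sum>i=1..n. real (w i)) / real n) \<longlonglongrightarrow> \<alpha>" and "0 \<le> \<alpha>" and e: "e > 0"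
  obtains K where "\<And>s l. state (kseq m w) s \<Longrightarrow>
    \<bar>real (weight (pat (kseq m w) s l)) - 1 / (real m + \<alpha>) * real l\<bar> \<le> e * real l + K"
proof -
  let ?F = "\<lambda>t. real (fsum w 1 t)"
  have F: "?F n = (\<Sum>i=1..n. real (w i))" for n
    by (induction n) (auto simp: fsum_Suc)
  have "\<forall>\<^sub>F t in sequentially. dist (?F t / real t) \<alpha> < e"
    using tendstoD[OF lim e] by (simp only: F)
  then obtain N where N: "\<And>t. t \<ge> N \<Longrightarrow> \<bar>?F t / real t - \<alpha>\<bar> < e"
    by (auto simp: eventually_sequentially dist_real_def)
  \<comment> \<open>\<open>K\<close> absorbs the finitely many initial \<open>t\<close> for which
    the limit gives no estimate.\<close>
  define K where "K = (\<Sum>t<Suc N. \<bar>?F t - \<alpha> * real t\<bar>)"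
  have dev: "\<bar>?F t - \<alpha> * real t\<bar> \<le> e * real t + K" for t
  proof (cases "t < Suc N")
    case True
    then have "\<bar>?F t - \<alpha> * real t\<bar> \<le> K" unfolding K_def
      by (intro member_le_sum[of t "{..<Suc N}" "\<lambda>t. \<bar>?F t - \<alpha> * real t\<bar>"]) auto
    then show ?thesis using e by (simp add: add_increasing)
  next
    case False
    then have t: "t \<ge> N" "t > 0" by auto
    have "\<bar>?F t - \<alpha> * real t\<bar> = \<bar>?F t / real t - \<alpha>\<bar> * real t"
      using t by (simp add: field_simps flip: abs_mult_pos')
    also have "\<dots> \<le> e * real t" using N[OF t(1)] by (intro mult_right_mono) auto
    finally show ?thesis by (simp add: K_def sum_nonneg add_increasing2)
  qed
  show thesis
  proof (rule that[of "K + real C + real m"])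
    fix s l assume s: "state (kseq m w) s"
    obtain i j where ij: "s = (i, j)" by (cases s)
    define t where "t = weight (pat (kseq m w) s l)"
    have k1: "1 \<le> kseq m w i" for i using m by (simp add: kseq_def)
    obtain j' where j': "1 \<le> j'" "j' \<le> kseq m w (i + t)" "l + j = (\<Sum>r<t. kseq m w (i + r)) + j'"
      using length_eq_block_sum[OF k1 s[unfolded ij], of l] by (auto simp: t_def ij)
    have st: "1 \<le> i" "1 \<le> j" "j \<le> m + w i" using s by (auto simp: ij state_def kseq_def)
    have "w i \<le> 1" "w (i + t) \<le> 1" using bin st by (auto simp: le_Suc_eq)
    then have jj: "j \<le> m + 1" "j' \<le> m + 1" using st j' by (auto simp: kseq_def)
    have "(\<Sum>r<t. kseq m w (i + r)) = m * t + fsum w i t"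
      by (simp add: kseq_def fsum_def sum.distrib)
    then have "l + j = m * t + fsum w i t + j'" using j' by simp
    then have "real l + real j = real m * real t + real (fsum w i t) + real j'"
      by (metis of_nat_add of_nat_mult)
    \<comment> \<open>The discrepancy bound replaces the sum from \<open>i\<close> by the sum from
      1, which makes the estimate uniform in the start of the path.\<close>
    moreover have "\<bar>real (fsum w i t) - ?F t\<bar> \<le> real C"
      using C[OF st(1), of t] by linarith
    ultimately have d: "\<bar>real m * real t + ?F t - real l\<bar> \<le> real C + real m"
      using jj st j' by linarith
    have "\<bar>(real m + \<alpha>) * real t - real l\<bar> \<le> \<bar>real m * real t + ?F t - real l\<bar> + \<bar>?F t - \<alpha> * real t\<bar>"
      by (simp add: algebra_simps abs_if)
    also have "\<dots> \<le> e * real t + (K + real C + real m)" using d dev[of t] by linarith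
    also have "\<dots> \<le> e * real l + (K + real C + real m)"
      using weight_pat_le[of "kseq m w" s l] e by (simp add: t_def)
    finally have bd: "\<bar>(real m + \<alpha>) * real t - real l\<bar> \<le> e * real l + (K + real C + real m)" .
    have ma: "real m + \<alpha> \<ge> 1" using m \<open>0 \<le> \<alpha>\<close> by simp
    have "(real m + \<alpha>) * real t - real l = (real m + \<alpha>) * (real t - 1 / (real m + \<alpha>) * real l)"
      using ma by (simp add: field_simps)
    then have "\<bar>(real m + \<alpha>) * real t - real l\<bar> = (real m + \<alpha>) * \<bar>real t - 1 / (real m + \<alpha>) * real l\<bar>"
      using ma by (simp only: abs_mult)
    moreover have "1 * \<bar>real t - 1 / (real m + \<alpha>) * real l\<bar> \<le> (real m + \<alpha>) * \<bar>real t - 1 / (real m + \<alpha>) * real l\<bar>"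
      using ma by (intro mult_right_mono) auto
    ultimately show "\<bar>real (weight (pat (kseq m w) s l)) - 1 / (real m + \<alpha>) * real l\<bar> \<le> e * real l + (K + real C + real m)"
      using bd by (simp only: t_def mult_1)
  qed
qed

section \<open>The exponents of both algebras\<close>

lemma sum_Pow_power_card:
  fixes y :: real
  assumes "finite A"
  shows "(\<Sum>S\<in>Pow A. y ^ card S) = (1 + y) ^ card A"
  using assms
proof (induction A)
  case (insert a A)
  have "(\<Sum>S\<in>insert a ` Pow A. y ^ card S) = (\<Sum>S\<in>Pow A. y ^ card (insert a S))"
    using insert by (intro sum.reindex[unfolded o_def]) (auto simp: inj_on_def)
  also have "\<dots> = (\<Sum>S\<in>Pow A. y * y ^ card S)"
  proof (intro sum.cong refl)
    fix S assume "S \<in> Pow A"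
    then have "finite S" "a \<notin> S" using insert finite_subset by auto
    then show "y ^ card (insert a S) = y * y ^ card S" by simp
  qed
  finally have 1: "(\<Sum>S\<in>insert a ` Pow A. y ^ card S) = y * (\<Sum>S\<in>Pow A. y ^ card S)"
    by (simp add: sum_distrib_left)
  have "(\<Sum>S\<in>Pow (insert a A). y ^ card S) = (\<Sum>S\<in>Pow A. y ^ card S) + (\<Sum>S\<in>insert a ` Pow A. y ^ card S)"
    unfolding Pow_insert using insert by (intro sum.union_disjoint) auto
  then show ?case using 1 insert by (simp add: algebra_simps)
qed simp

lemma Asharp_carrier_eq:
  "Asharp_carrier m w = {x. finite (supp x) \<and> supp x \<subseteq> Collect (valid_idx (kseq m w))}"
  by (auto simp: Asharp_carrier_def)

lemma A_carrier_eq: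
  "A_carrier m w = {x. finite (supp x) \<and> supp x \<subseteq> Collect (valid_idx (kseq m w)) - {U}}"
  by (auto simp: A_carrier_def Asharp_carrier_def supp_def)

theorem theorem1:
  fixes m :: nat and w :: "nat \<Rightarrow> nat" and \<alpha> :: real
  assumes "m \<ge> 2"
    and "\<forall>i\<ge>1. w i \<in> {0, 1}"
    and "sturmian w \<or> (periodic_word w \<and> (\<exists>i\<ge>1. w i \<noteq> 0))"
    and "(\<lambda>n. (\<Sum>i=1..n. real (w i)) / real n) \<longlonglongrightarrow> \<alpha>"
  shows "has_PI_exp (amult (kseq m w)) (Asharp_carrier m w :: (bidx \<Rightarrow> 'f::field_char_0) set)
           (1 + Phi0 (1 / (real m + \<alpha>)))
       \<and> has_PI_exp (amult (kseq m w)) (A_carrier m w :: (bidx \<Rightarrow> 'f) set)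
           (Phi0 (1 / (real m + \<alpha>)))"
proof -
  let ?k = "kseq m w"
  let ?cs = "\<lambda>n. real (codim n (amult ?k) (Asharp_carrier m w :: (bidx \<Rightarrow> 'f) set))"
  let ?ca = "\<lambda>n. real (codim n (amult ?k) (A_carrier m w :: (bidx \<Rightarrow> 'f) set))"
  define \<beta> where "\<beta> = 1 / (real m + \<alpha>)"
  define \<Phi> where "\<Phi> = Phi0 \<beta>"
  have "0 \<le> \<alpha>"
    by (rule LIMSEQ_le_const[OF assms(4)]) (auto intro!: divide_nonneg_nonneg sum_nonneg)
  then have \<beta>: "0 < \<beta>" "\<beta> < 1" using assms(1) by (auto simp: \<beta>_def)
  have \<Phi>1: "1 < \<Phi>" unfolding \<Phi>_def by (rule Phi0_gt_1[OF \<beta>])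
  have k1: "1 \<le> ?k i" for i using assms(1) by (simp add: kseq_def)
  obtain C where C: "\<And>n. finite (subwords w n)" "\<And>n. card (subwords w n) \<le> n + C"
    "\<And>p L. p \<ge> 1 \<Longrightarrow> \<bar>int (fsum w p L) - int (fsum w 1 L)\<bar> \<le> int C"
    using sturmian_or_periodic_bounds[of w] assms(2,3) by blast
  have m1: "1 \<le> m" using assms(1) by simp
  have dev: "\<exists>K. \<forall>s l. state ?k s \<longrightarrow> \<bar>real (weight (pat ?k s l)) - \<beta> * real l\<bar> \<le> e * real l + K"
    if "e > 0" for e
    using weight_pat_deviation[OF m1 assms(2) C(3) assms(4) \<open>0 \<le> \<alpha>\<close> that] unfolding \<beta>_def by metis
  note pats = pats_bound[OF assms(2) C(1), of m]

  \<comment> \<open>\<open>D l\<close> bounds the number of functionals belonging to one set of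
    \<open>l\<close> nonunit variables, up to the support \<open>Mon n\<close>; their paths have
    \<open>l - 1\<close> letters.\<close>
  define D where "D l = l * (\<Sum>u\<in>pats ?k (l - 1). l choose weight u)" for l
  have D: "\<exists>K>0. \<forall>l. real (D l) \<le> K * y ^ l" if y: "\<Phi> < y" for y
  proof -
    have y0: "0 < y" using y \<Phi>1 by simp
    have near: "\<exists>K. \<forall>l. \<forall>t\<in>weight ` pats ?k (l - 1). t \<le> l \<and> \<bar>real t - \<beta> * real l\<bar> \<le> e * real l + K"
      if "e > 0" for e
    proof -
      obtain K where K: "\<And>s l. state ?k s \<Longrightarrow> \<bar>real (weight (pat ?k s l)) - \<beta> * real l\<bar> \<le> e * real l + K"
        using dev[OF \<open>e > 0\<close>] by blast
      \<comment> \<open>Passing from length \<open>l - 1\<close> to \<open>l\<close> shifts the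
        expected weight by at most 1, hence \<open>K + 1\<close>.\<close>
      have "t \<le> l \<and> \<bar>real t - \<beta> * real l\<bar> \<le> e * real l + (K + 1)"
        if t: "t \<in> weight ` pats ?k (l - 1)" for l t
      proof -
        obtain s where s: "state ?k s" "t = weight (pat ?k s (l - 1))" using t by (auto simp: pats_def)
        have "t \<le> l" using weight_pat_le[of ?k s "l - 1"] s by simp
        have l1: "real (l - 1) \<le> real l" "real l - real (l - 1) \<le> 1" by auto
        have a: "\<bar>real t - \<beta> * real (l - 1)\<bar> \<le> e * real (l - 1) + K" using K[OF s(1)] s(2) by simp
        have b: "e * real (l - 1) \<le> e * real l" using \<open>e > 0\<close> l1 by (intro mult_left_mono) auto
        have "\<beta> * (real l - real (l - 1)) \<le> 1 * 1" using \<beta> l1 by (intro mult_mono) auto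
        moreover have "0 \<le> \<beta> * (real l - real (l - 1))" using \<beta> l1 by (intro mult_nonneg_nonneg) auto
        ultimately have "\<bar>\<beta> * real l - \<beta> * real (l - 1)\<bar> \<le> 1" by (simp only: right_diff_distrib)
        then show ?thesis using a b \<open>t \<le> l\<close> by linarith
      qed
      then show ?thesis by blast
    qed
    from quadratic_times_binomial_le[OF \<beta> y[unfolded \<Phi>_def] near]
    obtain K where K: "K > 0"
      "\<forall>l. \<forall>t\<in>weight ` pats ?k (l - 1). real (l + 1) ^ 2 * real (l choose t) \<le> K * y ^ l"
      by auto
    let ?M = "real (m + 1) * real (C + 1)"
    have "real (D l) \<le> ?M * K * y ^ l" for l
    proof (cases l)
      case 0
      then show ?thesis using K by (simp add: D_def)
    next
      case (Suc l')
      have "card (pats ?k l') \<le> (m + 1) * (Suc l' + C)"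
        using pats(2)[of l'] C(2)[of "Suc l'"] by (meson le_trans mult_le_mono2)
      also have "\<dots> \<le> (m + 1) * ((C + 1) * (l + 1))" unfolding Suc by (intro mult_le_mono2) simp
      finally have "card (pats ?k l') \<le> (m + 1) * ((C + 1) * (l + 1))" .
      then have "real (card (pats ?k l')) \<le> real ((m + 1) * ((C + 1) * (l + 1)))" by (simp only: of_nat_le_iff)
      then have cp: "real (card (pats ?k (l - 1))) \<le> ?M * real (l + 1)" unfolding Suc by (simp only: of_nat_mult mult.assoc diff_Suc_1)
      have "real (l + 1) ^ 2 * (\<Sum>u\<in>pats ?k (l - 1). real (l choose weight u)) = (\<Sum>u\<in>pats ?k (l - 1). real (l + 1) ^ 2 * real (l choose weight u))"
        by (rule sum_distrib_left)
      also have "\<dots> \<le> real (card (pats ?k (l - 1))) * (K * y ^ l)"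
        by (rule sum_bounded_above) (use K in auto)
      also have "\<dots> \<le> ?M * real (l + 1) * (K * y ^ l)"
        using cp K y0 by (intro mult_right_mono) auto
      finally have "real (l + 1) * (real (l + 1) * (\<Sum>u\<in>pats ?k (l - 1). real (l choose weight u))) \<le> real (l + 1) * (?M * K * y ^ l)"
        by (simp only: power2_eq_square mult_ac)
      \<comment> \<open>One factor \<open>l + 1\<close> of the square was spent on the number of
        patterns; the other dominates the factor \<open>l\<close> in \<open>D l\<close>.\<close>
      then have "real (l + 1) * (\<Sum>u\<in>pats ?k (l - 1). real (l choose weight u)) \<le> ?M * K * y ^ l"
        by (rule mult_left_le_imp_le) simp
      moreover have "real (D l) \<le> real (l + 1) * (\<Sum>u\<in>pats ?k (l - 1). real (l choose weight u))"
        unfolding D_def of_nat_mult of_nat_sum by (intro mult_right_mono sum_nonneg) auto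
      ultimately show ?thesis by linarith
    qed
    then show ?thesis using K(1) by (intro exI[of _ "?M * K"]) auto
  qed

  define T where "T n = weight (pat ?k (1, 1) n)" for n
  have s11: "state ?k (1, 1)" using k1 by (simp add: state_def)
  have "(\<lambda>n. real (T n) / real n) \<longlonglongrightarrow> \<beta>"
  proof (rule LIMSEQ_I)
    fix r :: real assume r: "0 < r"
    obtain K where K: "\<And>l. \<bar>real (T l) - \<beta> * real l\<bar> \<le> r / 2 * real l + K"
      using dev[of "r / 2"] r s11 by (auto simp: T_def)
    obtain N where N: "real N > 2 * \<bar>K\<bar> / r" using reals_Archimedean2 by blast
    show "\<exists>no. \<forall>n\<ge>no. norm (real (T n) / real n - \<beta>) < r"
    proof (intro exI[of _ "Suc N"] allI impI)
      fix n assume n: "Suc N \<le> n"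
      then have n0: "0 < real n" by simp
      have "2 * \<bar>K\<bar> / r < real n" using N n by simp
      then have "\<bar>K\<bar> < r / 2 * real n" using r by (simp add: field_simps)
      then have "\<bar>real (T n) - \<beta> * real n\<bar> < r * real n" using K[of n] by simp
      moreover have "real (T n) / real n - \<beta> = (real (T n) - \<beta> * real n) / real n" using n0 by (simp add: field_simps)
      ultimately show "norm (real (T n) / real n - \<beta>) < r" using n0 by (simp add: field_simps)
    qed
  qed
  note evT = eventually_binomial_ge[OF \<beta> this]

  have "has_PI_exp (amult ?k) (A_carrier m w :: (bidx \<Rightarrow> 'f) set) \<Phi>"
    unfolding has_PI_exp_def
  proof (rule root_tendsto_of_exponential_bounds)
    fix y assume y: "\<Phi> < y"
    obtain K where K: "K > 0" "\<And>l. real (D l) \<le> K * y ^ l" using D[OF y] by blast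
    have "?ca n \<le> (1 + K) * y ^ n" for n
    proof -
      \<comment> \<open>Without a unit the set of nonunit variables is always
        \<open>{1..n}\<close>.\<close>
      have "codim n (amult ?k) (A_carrier m w :: (bidx \<Rightarrow> 'f) set) \<le> 1 + (\<Sum>S\<in>{{1..n}}. D (card S))"
        unfolding A_carrier_eq D_def
      proof (rule codim_le_sum)
        have "Ba \<in> Collect (valid_idx ?k) - {U}" by (simp add: valid_idx_def)
        then show "Collect (valid_idx ?k) - {U} \<noteq> {}" by blast
      qed (use k1 pats in \<open>auto simp: image_subset_iff\<close>)
      then have "?ca n \<le> 1 + real (D n)" by simp
      also have "\<dots> \<le> y ^ n + K * y ^ n" using K(2)[of n] y \<Phi>1 by (intro add_mono) auto
      finally show ?thesis by (simp add: algebra_simps)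
    qed
    then show "\<exists>K>0. \<forall>\<^sub>F n in sequentially. ?ca n \<le> K * y ^ n" using K by (intro exI[of _ "1 + K"]) auto
  next
    fix y :: real assume y: "0 < y" "y < \<Phi>"
    have "\<forall>\<^sub>F n in sequentially. y ^ Suc n \<le> real (n choose T n)" using evT y by (simp add: \<Phi>_def)
    then have "\<forall>\<^sub>F n in sequentially. 1 * y ^ Suc n \<le> real (Suc n) * ?ca (Suc n)"
    proof eventually_elim
      case (elim n)
      have "(Suc n choose Suc n) * ((Suc n - 1) choose weight (pat ?k (1, 1) (Suc n - 1)))
          \<le> codim (Suc n) (amult ?k) (A_carrier m w :: (bidx \<Rightarrow> 'f) set)"
        unfolding A_carrier_eq
        by (rule codim_ge_binomials[OF k1 s11]) (use k1 in \<open>auto simp: valid_idx_def\<close>)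
      then have "real (n choose T n) \<le> ?ca (Suc n)" by (simp add: T_def)
      also have "\<dots> \<le> real (Suc n) * ?ca (Suc n)" by (simp add: mult_le_cancel_right1 algebra_simps)
      finally show ?case using elim by simp
    qed
    then have "\<forall>\<^sub>F n in sequentially. 1 * y ^ n \<le> real n * ?ca n"
      by (rule eventually_sequentially_Suc[THEN iffD1])
    then show "\<exists>K>0. \<forall>\<^sub>F n in sequentially. K * y ^ n \<le> real n * ?ca n" by (intro exI[of _ 1]) auto
  qed (use \<Phi>1 in auto)

  moreover have "has_PI_exp (amult ?k) (Asharp_carrier m w :: (bidx \<Rightarrow> 'f) set) (1 + \<Phi>)"
    unfolding has_PI_exp_def
  proof (rule root_tendsto_of_exponential_bounds)
    fix y assume y: "1 + \<Phi> < y"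
    \<comment> \<open>\<open>D\<close> is used at \<open>y - 1\<close>, because the sum of
      \<open>(y - 1) ^ card S\<close> over all subsets of \<open>{1..n}\<close> is
      \<open>y ^ n\<close>.\<close>
    obtain K where K: "K > 0" "\<And>l. real (D l) \<le> K * (y - 1) ^ l" using D[of "y - 1"] y by auto
    have "?cs n \<le> (1 + K) * y ^ n" for n
    proof -
      have "codim n (amult ?k) (Asharp_carrier m w :: (bidx \<Rightarrow> 'f) set) \<le> 1 + (\<Sum>S\<in>Pow {1..n}. D (card S))"
        unfolding Asharp_carrier_eq D_def
      proof (rule codim_le_sum)
        have "U \<in> Collect (valid_idx ?k)" by (simp add: valid_idx_def)
        then show "Collect (valid_idx ?k) \<noteq> {}" by blast
      qed (use k1 pats in auto)
      then have "?cs n \<le> real (1 + (\<Sum>S\<in>Pow {1..n}. D (card S)))" by (simp only: of_nat_le_iff)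
      also have "\<dots> = 1 + (\<Sum>S\<in>Pow {1..n}. real (D (card S)))" by simp
      also have "\<dots> \<le> 1 + (\<Sum>S\<in>Pow {1..n}. K * (y - 1) ^ card S)" using K(2) by (intro add_left_mono sum_mono)
      also have "\<dots> = 1 + K * y ^ n" using sum_Pow_power_card[of "{1..n}" "y - 1"] by (simp flip: sum_distrib_left)
      also have "\<dots> \<le> y ^ n + K * y ^ n" using y \<Phi>1 by (intro add_right_mono) simp
      finally show ?thesis by (simp add: algebra_simps)
    qed
    then show "\<exists>K>0. \<forall>\<^sub>F n in sequentially. ?cs n \<le> K * y ^ n" using K by (intro exI[of _ "1 + K"]) auto
  next
    fix y :: real assume y: "0 < y" "y < 1 + \<Phi>"
    \<comment> \<open>The maximum with 1 makes the powers of \<open>x\<close> nondecreasing;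
      \<open>x < \<Phi>\<close> persists since \<open>\<Phi> > 1\<close>.\<close>
    define x where "x = max 1 (y - 1)"
    have x: "1 \<le> x" "x < \<Phi>" "y \<le> 1 + x" using y \<Phi>1 by (auto simp: x_def)
    then obtain N where N: "\<And>n. n \<ge> N \<Longrightarrow> x ^ Suc n \<le> real (n choose T n)"
      using evT[of x] by (auto simp: \<Phi>_def eventually_sequentially)
    \<comment> \<open>This constant makes the bound valid also for the finitely many
      \<open>n\<close> below \<open>N\<close>.\<close>
    define d where "d = 1 / x ^ N"
    have d: "0 < d" "d \<le> 1" using x by (auto simp: d_def field_simps)
    have dT: "d * x ^ Suc n \<le> real (n choose T n)" for n
    proof (cases "N \<le> n")
      case True
      have "d * x ^ Suc n \<le> 1 * x ^ Suc n" using d x by (intro mult_right_mono) auto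
      then show ?thesis using N[OF True] by simp
    next
      case False
      then have "x ^ Suc n \<le> x ^ N" using x by (intro power_increasing) auto
      then have "d * x ^ Suc n \<le> 1" using x by (simp add: d_def field_simps)
      moreover have "0 < n choose T n" using weight_pat_le[of ?k "(1, 1)" n] by (simp add: T_def)
      ultimately show ?thesis by linarith
    qed
    have big: "d * (real (n choose l) * x ^ l) \<le> ?cs n" if "4 \<le> l" for n l
    proof -
      have "(n choose l) * ((l - 1) choose weight (pat ?k (1, 1) (l - 1)))
          \<le> codim n (amult ?k) (Asharp_carrier m w :: (bidx \<Rightarrow> 'f) set)"
        unfolding Asharp_carrier_eq
        by (rule codim_ge_binomials[OF k1 s11]) (use k1 that in \<open>auto simp: valid_idx_def\<close>)
      then have "real ((n choose l) * ((l - 1) choose T (l - 1))) \<le> ?cs n" unfolding T_def by (simp only: of_nat_le_iff)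
      moreover have "real (n choose l) * (d * x ^ Suc (l - 1)) \<le> real (n choose l) * real ((l - 1) choose T (l - 1))"
        by (intro mult_left_mono dT) auto
      moreover have "Suc (l - 1) = l" using that by simp
      ultimately show ?thesis by (simp add: mult_ac)
    qed
    \<comment> \<open>The separating monomials were built for sizes at least 4. The terms of smaller
      size are dominated by that of size 4, as binomial coefficients increase up to the middle and
      \<open>8 \<le> n\<close>.\<close>
    have all: "d * (real (n choose l) * x ^ l) \<le> ?cs n" if n: "8 \<le> n" for n l
    proof (cases "4 \<le> l")
      case False
      have "real (n choose l) \<le> real (n choose 4)" using n False by (simp add: binomial_mono)
      moreover have "x ^ l \<le> x ^ 4" using x False by (intro power_increasing) auto
      ultimately have "real (n choose l) * x ^ l \<le> real (n choose 4) * x ^ 4" using x by (intro mult_mono) auto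
      then have "d * (real (n choose l) * x ^ l) \<le> d * (real (n choose 4) * x ^ 4)" using d by (intro mult_left_mono) auto
      then show ?thesis using big[of 4 n] by linarith
    qed (rule big)
    have "d / 2 * y ^ n \<le> real n * ?cs n" if n: "8 \<le> n" for n
    proof -
      \<comment> \<open>The expansion of \<open>(x + 1) ^ n\<close> has \<open>n + 1\<close> terms,
        each at most the codimension after scaling by \<open>d\<close>;
        \<open>n + 1 \<le> 2 * n\<close> accounts for \<open>d / 2\<close>.\<close>
      have "d * y ^ n \<le> d * (x + 1) ^ n" using y x d by (intro mult_left_mono power_mono) auto
      also have "\<dots> = (\<Sum>l\<le>n. d * (real (n choose l) * x ^ l))"
        by (simp add: binomial_ring[of x 1 n] sum_distrib_left)
      also have "\<dots> \<le> (\<Sum>l\<le>n. ?cs n)" by (intro sum_mono all n)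
      also have "\<dots> = real (n + 1) * ?cs n" by simp
      also have "\<dots> \<le> (2 * real n) * ?cs n" using n by (intro mult_right_mono) auto
      finally show ?thesis by simp
    qed
    then show "\<exists>K>0. \<forall>\<^sub>F n in sequentially. K * y ^ n \<le> real n * ?cs n"
      using d by (intro exI[of _ "d / 2"]) (auto simp: eventually_sequentially)
  qed (use \<Phi>1 in auto)
  ultimately show ?thesis unfolding \<Phi>_def \<beta>_def by blast
qed

end
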